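(* Let $G$ be a simple 2-connected graph of order $n\ge 13$. If $G$ is $\{K_{1,3}, P_6\}$-free, then $G$ is chorded pancyclic.
   Context: $G$ is $\{H_1,\dots,H_r\}$-free if $G$ contains no induced subgraph isomorphic to any $H_i$. $K_{1,3}$ is the claw and $P_t$ denotes the path on $t$ vertices. A chorded cycle is a cycle $C$ such that $G$ has an edge joining two vertices nonconsecutive on $C$. A graph $G$ of order $n$ is chorded pancyclic if it contains a chorded cycle of every length $m$ with $4\le m\le n$. *)

theory Defs
  imports "Graph_Theory.Graph_Theory"
begin

text \<open>
  A simple graph is a finite, loop-free, symmetric digraph without parallel arcs
  (\<^locale>\<open>pair_graph\<close>): an undirected edge joining \<open>u\<close> and \<open>v\<close> is the pair of arcs
  \<open>(u, v)\<close> and \<open>(v, u)\<close>.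
\<close>

definition claw :: "nat pair_pre_digraph" where
  "claw = \<lparr>pverts = {0, 1, 2, 3}, parcs = {0} \<times> {1, 2, 3} \<union> {1, 2, 3} \<times> {0}\<rparr>"

definition path_graph :: "nat \<Rightarrow> nat pair_pre_digraph" where
  "path_graph t = \<lparr>pverts = {..<t},
     parcs = {(i, j). i < t \<and> j < t \<and> (j = Suc i \<or> i = Suc j)}\<rparr>"

definition induced_free :: "'b pair_pre_digraph set \<Rightarrow> 'a pair_pre_digraph \<Rightarrow> bool" where
  "induced_free \<F> G \<longleftrightarrow>
     (\<forall>F\<in>\<F>. \<not> (\<exists>H. induced_subgraph H (with_proj G) \<and> digraph_iso H (with_proj F)))"

definition k_connected :: "nat \<Rightarrow> 'a pair_pre_digraph \<Rightarrow> bool" where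
  "k_connected k G \<longleftrightarrow> k < card (pverts G) \<and>
     (\<forall>X \<subseteq> pverts G. card X < k \<longrightarrow> connected (with_proj G \<restriction> (pverts G - X)))"

text \<open>
  A cycle is given by the list of its arcs in one direction of traversal, so \<open>length p\<close> is its
  length. In a symmetric digraph a single edge traversed back and forth is a directed cycle of
  length 2; the bound on the length excludes it. The vertices of the cycle are the tails of its
  arcs, and two distinct vertices are consecutive on it iff an arc of the list joins them in one
  of the two directions.
\<close>

definition chorded_cycle :: "'a pair_pre_digraph \<Rightarrow> ('a \<times> 'a) awalk \<Rightarrow> bool" where
  "chorded_cycle G p \<longleftrightarrow> pre_digraph.cycle (with_proj G) p \<and> 3 \<le> length p \<and>
     (\<exists>u \<in> fst ` set p. \<exists>v \<in> fst ` set p.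
        (u, v) \<in> parcs G \<and> (u, v) \<notin> set p \<and> (v, u) \<notin> set p)"

definition chorded_pancyclic :: "'a pair_pre_digraph \<Rightarrow> bool" where
  "chorded_pancyclic G \<longleftrightarrow>
     (\<forall>m. 4 \<le> m \<and> m \<le> card (pverts G) \<longrightarrow> (\<exists>p. chorded_cycle G p \<and> length p = m))"

lemma claw_complete_bipartite: "K\<^bsub>1,3\<^esub> (with_proj claw)"
  unfolding complete_bipartite_digraph_pair_def
  by (rule conjI, simp add: claw_def, rule exI[of _ "{0}"], rule exI[of _ "{1, 2, 3}"])
     (auto simp: claw_def)

lemma pair_graph_claw: "pair_graph claw"
  by unfold_locales (auto simp: claw_def symmetric_def sym_def)

lemma pair_graph_path_graph: "pair_graph (path_graph t)"
proof -
  have "finite (parcs (path_graph t))"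
    by (rule finite_subset[of _ "{..<t} \<times> {..<t}"]) (auto simp: path_graph_def)
  then show ?thesis
    by unfold_locales (auto simp: path_graph_def symmetric_def sym_def)
qed

end

(*
  Suppose a cycle C of length at least 5 misses a vertex. If an outside vertex v has two neighbours
  on C, then C and v span a cycle. Otherwise take a shortest path through the outside joining two
  vertices of C; it has two to four inner vertices, and P6-freeness makes C so dense around its
  ends that the path closes up with all but the right number of vertices of C. So from a 5-cycle
  one gets cycles of all lengths from 5 to n, and those of length at least 7 have chords because
  they would otherwise contain an induced P6.

  For the lengths 4, 5 and 6, suppose that no chorded cycle of that length exists and consider an
  induced cycle Z of length 4, 5 or 6 (for 5, a shortest cycle of length at least 5 is one).
  The few ways in which a vertex can be attached to Z each occur only once or twice, and except
  for |Z| = 4 no vertex has distance two from Z, so the graph has at most 12 vertices.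
*)
theory Submission
  imports Defs
begin

section \<open>Extending cycles\<close>

text \<open>Inserting an outside path with \<open>k\<close> inner vertices lengthens the cycle by
  \<open>k\<close>. The obstacle is to gain exactly one vertex, so \<open>k - 1\<close> vertices of
  the cycle have to be bypassed. As \<open>k\<close> is at most 4, three vertices between the two
  ends are enough room, and this is why the extension starts at length 5. The chorded 5-cycle has to
  be found before the other lengths: its cycle starts the extension, which supplies the 6-cycle and
  all longer ones, and its chord cuts off the 4-cycle around which length 4 is settled. The bound 13
  comes from two counts around an induced 6-cycle that end at 12. Without chorded 5-cycles, each of
  six kinds of attachment occurs at most once. Without chorded 6-cycles, each kind occurs at most
  twice, but neighbouring kinds exclude each other, which leaves two vertices for each of three
  pairs. All other counts end at 11 or less.\<close>

locale claw_P6_free =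
  fixes V :: "'a set" and E :: "'a \<Rightarrow> 'a \<Rightarrow> bool"
  assumes finite_V: "finite V"
    and E_sym: "E u v \<Longrightarrow> E v u"
    and E_irrefl [simp]: "\<not> E u u"
    and E_in_V: "E u v \<Longrightarrow> u \<in> V"
    and claw_free: "\<lbrakk>E x a; E x b; E x c; a \<noteq> b; a \<noteq> c; b \<noteq> c\<rbrakk> \<Longrightarrow> E a b \<or> E a c \<or> E b c"
    and P6_free: "\<lbrakk>distinct [a, b, c, d, e, f]; E a b; E b c; E c d; E d e; E e f\<rbrakk> \<Longrightarrow>
      E a c \<or> E a d \<or> E a e \<or> E a f \<or> E b d \<or> E b e \<or> E b f \<or> E c e \<or> E c f \<or> E d f"
begin

lemma E_commute: "E u v \<longleftrightarrow> E v u"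
  using E_sym by blast

lemma E_neq: "E u v \<Longrightarrow> u \<noteq> v"
  by auto

lemma successively_E_rev [simp]: "successively E (rev xs) \<longleftrightarrow> successively E xs"
  by (simp add: E_commute)

definition cyc :: "'a list \<Rightarrow> bool" where
  "cyc xs \<longleftrightarrow> distinct xs \<and> 3 \<le> length xs \<and> successively E xs \<and> E (last xs) (hd xs)"

lemma cyc_rotate: "cyc (xs @ ys) \<Longrightarrow> cyc (ys @ xs)"
  by (cases "xs = []"; cases "ys = []") (auto simp: cyc_def successively_append_iff)

lemmas path_simps = successively_append_iff successively_Cons hd_append last_append hd_rev last_rev

lemma cyc_split_at:
  assumes "cyc C" "a \<in> set C" "b \<in> set C" "a \<noteq> b"
  obtains A B where "cyc (a # A @ b # B)" "set (a # A @ b # B) = set C"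
    "length (a # A @ b # B) = length C"
proof -
  obtain X Y where XY: "C = X @ a # Y"
    using assms(2) by (meson split_list)
  have 1: "cyc (a # Y @ X)"
    using cyc_rotate[of X "a # Y"] assms(1) XY by simp
  have "b \<in> set (Y @ X)"
    using assms(3,4) XY by auto
  then obtain A B where "Y @ X = A @ b # B"
    by (meson split_list)
  moreover have "set (a # Y @ X) = set C" "length (a # Y @ X) = length C"
    using XY by auto
  ultimately show ?thesis
    using that 1 by metis
qed

text \<open>
  Claw-freeness makes the two cycle neighbours of an attachment vertex adjacent, so such a
  vertex can be moved to other places of the cycle; every forbidden adjacency below is refuted
  by rerouting the cycle through \<open>v\<close>, and what remains is an induced path on six vertices.
\<close>

lemma insert_common_neighbour:
  assumes C: "cyc (a # A @ b # B)" and v: "v \<notin> set (a # A @ b # B)" "E v a" "E v b"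
  shows "\<exists>C'. cyc C' \<and> set C' = insert v (set (a # A @ b # B))"
proof (rule ccontr)
  assume "\<not> ?thesis"
  then have none: "\<And>C'. cyc C' \<Longrightarrow> set C' = insert v (set (a # A @ b # B)) \<Longrightarrow> False"
    by blast
  have dist: "distinct (a # A @ b # B)" and sA: "successively E A" and sB: "successively E B"
    using C by (auto simp: cyc_def path_simps)
  note sym = E_sym[OF v(2)] E_sym[OF v(3)]
  have "A \<noteq> []"
    using none[of "a # v # b # B"] C v sym by (auto simp: cyc_def path_simps split: if_splits)
  moreover have "B \<noteq> []"
    using none[of "v # a # A @ [b]"] C v sym by (auto simp: cyc_def path_simps split: if_splits)
  ultimately have ne: "A \<noteq> []" "B \<noteq> []" .
  have ed: "E a (hd A)" "E (last A) b" "E b (hd B)" "E (last B) a"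
    using C ne by (auto simp: cyc_def path_simps)
  have sets: "hd A \<in> set A" "last A \<in> set A" "hd B \<in> set B" "last B \<in> set B"
    using ne by auto
  have vn: "\<not> E v (hd A)" "\<not> E v (last A)" "\<not> E v (hd B)" "\<not> E v (last B)"
    using none[of "a # v # A @ b # B"] none[of "a # A @ v # b # B"] none[of "a # A @ b # v # B"]
      none[of "a # A @ b # B @ [v]"] C v sym ne
    by (auto simp: cyc_def path_simps E_commute split: if_splits)
  have ne2: "last B \<noteq> hd A" "hd B \<noteq> last A" "v \<noteq> hd A" "v \<noteq> last A" "v \<noteq> hd B" "v \<noteq> last B"
    using sets dist v by auto
  have J: "E (last B) (hd A)" "E (hd B) (last A)"
    using claw_free[of a v "last B" "hd A"] claw_free[of b v "hd B" "last A"] ed sym vn ne2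
    by (auto simp: E_commute)
  \<comment> \<open>\<open>P\<close> is an initial piece of the arc consisting of neighbours of
    \<open>a\<close>. By \<open>J\<close> it can be entered from \<open>last B\<close>, and from its
    last vertex one can go straight to \<open>a\<close>. So the arc may be cut after any such piece,
    which treats the vertices \<open>x\<close> and \<open>x'\<close> chosen below alike.\<close>
  have bQ: "\<not> E (hd Q) b" "\<not> E v (hd Q)" if "A = P @ Q" "\<forall>p\<in>set P. E p a" "Q \<noteq> []" for P Q
  proof -
    show "\<not> E (hd Q) b"
    proof
      assume "E (hd Q) b"
      then have "cyc (v # a # rev P @ rev B @ rev Q @ [b])"
        using that ed dist sA sB J ne v sym
        by (auto simp: cyc_def path_simps E_commute split: if_splits)
      then show False
        using none that(1) by fastforce
    qed
    show "\<not> E v (hd Q)"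
    proof
      assume "E v (hd Q)"
      then have "cyc (Q @ b # B @ P @ [a, v])"
        using that ed dist sA sB J ne v sym
        by (auto simp: cyc_def path_simps E_commute split: if_splits)
      then show False
        using none that(1) by fastforce
    qed
  qed
  have aS: "\<not> E (hd S) a" "\<not> E v (hd S)" if "B = R @ S" "\<forall>p\<in>set R. E p b" "S \<noteq> []" for R S
  proof -
    show "\<not> E (hd S) a"
    proof
      assume "E (hd S) a"
      then have "cyc (v # b # rev R @ rev A @ rev S @ [a])"
        using that ed dist sA sB J ne v sym
        by (auto simp: cyc_def path_simps E_commute split: if_splits)
      then show False
        using none that(1) by fastforce
    qed
    show "\<not> E v (hd S)"
    proof
      assume "E v (hd S)"
      then have "cyc (S @ a # A @ R @ [b, v])"
        using that ed dist sA sB J ne v sym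
        by (auto simp: cyc_def path_simps E_commute split: if_splits)
      then show False
        using none that(1) by fastforce
    qed
  qed
  \<comment> \<open>With both arcs cut, an edge between the cut points closes a cycle that runs
    through \<open>a\<close>, \<open>v\<close>, \<open>b\<close> and all four pieces.\<close>
  have QS: "\<not> E (hd Q) (hd S)" if "A = P @ Q" "\<forall>p\<in>set P. E p a" "Q \<noteq> []"
    "B = R @ S" "\<forall>p\<in>set R. E p b" "S \<noteq> []" for P Q R S
  proof
    assume "E (hd Q) (hd S)"
    then have "cyc (S @ P @ a # v # b # rev R @ rev Q)"
      using that ed dist sA sB J ne v sym
      by (auto simp: cyc_def path_simps E_commute split: if_splits)
    then show False
      using none that(1,4) by fastforce
  qed
  \<comment> \<open>\<open>x\<close> is the last of the initial neighbours of \<open>c\<close> on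
    the arc and \<open>x'\<close> the first vertex that is not a neighbour; \<open>x'\<close> exists
    because the far end of the arc is not adjacent to \<open>c\<close>.\<close>
  have split: "\<exists>P x x' Q. L = P @ x # x' # Q \<and> (\<forall>p\<in>set P. E p c) \<and> E x c \<and> \<not> E x' c"
    if "L \<noteq> []" "E c (hd L)" "\<not> E (last L) c" for L c
  proof -
    define P where "P = takeWhile (\<lambda>p. E p c) L"
    define Q where "Q = dropWhile (\<lambda>p. E p c) L"
    have L: "L = P @ Q" by (simp add: P_def Q_def)
    have P: "\<forall>p\<in>set P. E p c" by (auto simp: P_def dest: set_takeWhileD)
    have "Q \<noteq> []" using that by (auto simp: Q_def)
    then obtain x' Q' where Q: "Q = x' # Q'" by (cases Q) auto
    then have x': "\<not> E x' c" unfolding Q_def by (metis hd_dropWhile list.distinct(1) list.sel(1))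
    have "P \<noteq> []" using that x' Q L by (metis E_commute append_Nil list.sel(1))
    then obtain P' x where "P = P' @ [x]" by (metis append_butlast_last_id)
    then show ?thesis using L P Q x' by auto
  qed
  have last: "\<not> E (last A) a" "\<not> E (last B) b"
  proof -
    show "\<not> E (last A) a"
    proof
      assume "E (last A) a"
      then have "cyc (v # b # B @ A @ [a])"
        using ed dist sA sB J ne v sym by (auto simp: cyc_def path_simps E_commute split: if_splits)
      then show False using none by fastforce
    qed
    show "\<not> E (last B) b"
    proof
      assume "E (last B) b"
      then have "cyc (v # a # A @ B @ [b])"
        using ed dist sA sB J ne v sym by (auto simp: cyc_def path_simps E_commute split: if_splits)
      then show False using none by fastforce
    qed
  qed
  obtain P x x' Q where A: "A = P @ x # x' # Q" "\<forall>p\<in>set P. E p a" "E x a" "\<not> E x' a"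
    using split[OF ne(1) ed(1) last(1)] by blast
  obtain R y y' S where B: "B = R @ y # y' # S" "\<forall>p\<in>set R. E p b" "E y b" "\<not> E y' b"
    using split[OF ne(2) ed(3) last(2)] by blast
  have n: "\<not> E x b" "\<not> E v x" "\<not> E x' b" "\<not> E v x'"
    using bQ[of P "x # x' # Q"] bQ[of "P @ [x]" "x' # Q"] A by auto
  have m: "\<not> E y a" "\<not> E v y" "\<not> E y' a" "\<not> E v y'"
    using aS[of R "y # y' # S"] aS[of "R @ [y]" "y' # S"] B by auto
  have k: "\<not> E x y" "\<not> E x y'" "\<not> E x' y" "\<not> E x' y'"
    using QS[of P "x # x' # Q" R "y # y' # S"] QS[of P "x # x' # Q" "R @ [y]" "y' # S"]
      QS[of "P @ [x]" "x' # Q" R "y # y' # S"] QS[of "P @ [x]" "x' # Q" "R @ [y]" "y' # S"] A B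
    by auto
  have e: "E x x'" "E y y'" using sA sB A B by (auto simp: path_simps)
  have d: "distinct [x', x, a, v, b, y]" "distinct [x', x, a, b, y, y']"
    using dist v A B by auto
  show False
  \<comment> \<open>The induced path is \<open>x' x a b y y'\<close> if \<open>a\<close> and
    \<open>b\<close> are adjacent, and the detour \<open>x' x a v b y\<close> otherwise.\<close>
  proof (cases "E a b")
    case True
    then show False
      using P6_free[OF d(2)] A B n m k e E_commute by metis
  next
    case False
    then show False
      using P6_free[OF d(1)] A B n m k e v E_commute by metis
  qed
qed

lemma cyc_in_V: "cyc C \<Longrightarrow> set C \<subseteq> V"
proof
  fix x assume C: "cyc C" and "x \<in> set C"
  then obtain X Y where XY: "C = X @ x # Y"
    by (meson split_list)
  then have "cyc (x # Y @ X)"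
    using cyc_rotate[of X "x # Y"] C by simp
  then show "x \<in> V"
    using E_in_V by (auto simp: cyc_def successively_Cons split: if_splits)
qed

section \<open>Outside paths with two, three and four inner vertices\<close>

lemma ear_second_vertex:
  assumes "distinct (a # l # M @ [b])" "successively E (a # l # M @ [b])" "M \<noteq> []" "\<not> E a b"
    and "v0 \<notin> set (a # l # M @ [b])" "v1 \<notin> set (a # l # M @ [b])"
    and "E a v0" "E v0 v1" "E v1 b"
    and "\<And>c. c \<in> set (a # l # M @ [b]) \<Longrightarrow> c \<noteq> a \<Longrightarrow> \<not> E v0 c"
    and "\<And>c. c \<in> set (a # l # M @ [b]) \<Longrightarrow> c \<noteq> b \<Longrightarrow> \<not> E v1 c"
  shows "E a (hd M) \<or> E (hd M) b"
proof (rule ccontr)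
  assume no: "\<not> ?thesis"
  have M: "hd M \<in> set M" using assms(3) by simp
  have e: "E a l" "E l (hd M)"
    using assms(2,3) by (auto simp: path_simps)
  have ne: "a \<noteq> b" "hd M \<noteq> a" "hd M \<noteq> b" "l \<noteq> a" "l \<noteq> b" "l \<noteq> hd M"
    using assms(1) M by auto
  \<comment> \<open>An edge from \<open>l\<close> to \<open>b\<close> would make \<open>l\<close>
    the centre of a claw with leaves \<open>a\<close>, \<open>b\<close>, \<open>hd M\<close>.
    Without it, \<open>hd M, l, a, v0, v1, b\<close> is an induced path.\<close>
  have nl: "\<not> E l b"
    using claw_free[of l a b "hd M"] e no ne assms(4) E_commute by metis
  have d: "distinct [hd M, l, a, v0, v1, b]"
    using assms(5,6) M ne E_neq[OF assms(8)] by auto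
  have "\<not> E v0 l" "\<not> E v0 (hd M)" "\<not> E v0 b" "\<not> E v1 a" "\<not> E v1 l" "\<not> E v1 (hd M)"
    using assms(10,11) ne M by auto
  then show False
    using P6_free[OF d] e no nl assms(4,7-9) E_commute by metis
qed

text \<open>Path and ear together would close to length \<open>length L + 4\<close>, so one vertex
  of \<open>L\<close> must be bypassed. If \<open>a\<close> and \<open>b\<close> are adjacent, this
  is \<open>l1\<close> or \<open>l2\<close>, since otherwise \<open>v1 v0 a l1 l2 l3\<close> is
  induced. If not, \<open>ear_second_vertex\<close> is used from both ends to bypass the first or
  the last vertex of \<open>L\<close>.\<close>

lemma ear2_cycle:
  assumes "distinct (a # L @ [b])" "successively E (a # L @ [b])" "3 \<le> length L"
    and "v0 \<notin> set (a # L @ [b])" "v1 \<notin> set (a # L @ [b])"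
    and "E a v0" "E v0 v1" "E v1 b"
    and N0: "\<And>c. c \<in> set (a # L @ [b]) \<Longrightarrow> c \<noteq> a \<Longrightarrow> \<not> E v0 c"
    and N1: "\<And>c. c \<in> set (a # L @ [b]) \<Longrightarrow> c \<noteq> b \<Longrightarrow> \<not> E v1 c"
    and cl: "\<And>x y. x \<in> set (L @ [b]) \<Longrightarrow> y \<in> set (L @ [b]) \<Longrightarrow> E a x \<Longrightarrow> E a y \<Longrightarrow> x \<noteq> y \<Longrightarrow> E x y"
  shows "\<exists>C. cyc C \<and> length C = length L + 3"
proof -
  note sym = E_sym[OF assms(6)] E_sym[OF assms(7)] E_sym[OF assms(8)]
  have v: "v0 \<noteq> v1" using assms(7) by auto
  show ?thesis
  proof (cases "E a b")
    case True
    obtain l1 l2 l3 L' where L: "L = l1 # l2 # l3 # L'"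
      using assms(3) by (metis Suc_le_length_iff numeral_3_eq_3)
    show ?thesis
    proof (cases "E a l2")
      case True
      then have "cyc (a # l2 # l3 # L' @ [b, v1, v0])"
        using assms(1,2,4,5) L sym v by (auto simp: cyc_def path_simps)
      then show ?thesis using L by fastforce
    next
      case False
      have e: "E a l1" "E l1 l2" "E l2 l3" using assms(2) L by auto
      have "E l1 l3"
      proof (rule ccontr)
        assume n: "\<not> E l1 l3"
        then have n3: "\<not> E a l3" using cl[of l1 l3] assms(1) e L by auto
        have d: "distinct [v1, v0, a, l1, l2, l3]" using assms(1,4,5) L v by auto
        have "\<not> E v1 a" "\<not> E v1 l1" "\<not> E v1 l2" "\<not> E v1 l3" "\<not> E v0 l1" "\<not> E v0 l2" "\<not> E v0 l3"
          using N0 N1 assms(1) L by auto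
        then show False using P6_free[OF d] e sym n n3 False by metis
      qed
      then have "cyc (a # l1 # l3 # L' @ [b, v1, v0])"
        using assms(1,2,4,5) L sym v by (auto simp: cyc_def path_simps)
      then show ?thesis using L by fastforce
    qed
  next
    case False
    obtain l K where LK: "L = l # K" using assms(3) by (cases L) auto
    then have "K \<noteq> []" using assms(3) by auto
    then obtain M r where K: "K = M @ [r]" by (metis append_butlast_last_id)
    have L: "L = l # M @ [r]" using LK K by simp
    have M: "M \<noteq> []" using assms(3) L by auto
    have 1: "E a (hd M) \<or> E (hd M) b"
      using ear_second_vertex[of a l "M @ [r]" b v0 v1] assms(1,2,4-10) False L M
        by (auto simp: hd_append)
    have 2: "E b (last M) \<or> E (last M) a"
      using ear_second_vertex[of b r "rev M @ [l]" a v1 v0] assms(1,2,4-10) False L M sym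
      by (auto simp: path_simps E_commute)
    have l: "E a l" "E r b" "E l (hd M)" "E (last M) r" using assms(2) L M by (auto simp: path_simps)
    have in_M: "hd M \<in> set M" "last M \<in> set M" using M by auto
    consider "E a (hd M)" | "E b (last M)" | "E (hd M) b" "E a (last M)"
      using 1 2 E_commute by blast
    then show ?thesis
    proof cases
      case 1
      then have "cyc (a # M @ [r, b, v1, v0])"
        using assms(1,2,4,5) L sym v M by (auto simp: cyc_def path_simps)
      then show ?thesis using L by fastforce
    next
      case 2
      then have "cyc (a # l # M @ [b, v1, v0])"
        using assms(1,2,4,5) L sym v M by (auto simp: cyc_def path_simps E_commute)
      then show ?thesis using L by fastforce
    next
      case 3
      \<comment> \<open>Neither end can be bypassed directly. Both \<open>l\<close> and
        \<open>last M\<close> are neighbours of \<open>a\<close>, hence adjacent, and running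
        \<open>M\<close> backwards ends at \<open>hd M\<close>, a neighbour of \<open>b\<close>;
        this leaves out \<open>r\<close>.\<close>
      have "E l (last M)" using cl[of l "last M"] 3(2) l(1) in_M L assms(1) by auto
      then have "cyc (a # l # rev M @ [b, v1, v0])"
        using assms(1,2,4,5) L sym v M 3 by (auto simp: cyc_def path_simps E_commute)
      then show ?thesis using L by fastforce
    qed
  qed
qed

text \<open>Two vertices must be bypassed. Within \<open>L\<close>, adjacency to \<open>a\<close>
  spreads along edges, because a failure would continue the ear to an induced path on six vertices.
  So \<open>a\<close> is adjacent to \<open>l3\<close>, and \<open>l1\<close> and \<open>l2\<close>
  can be left out.\<close>

lemma ear3_cycle:
  assumes "distinct (a # L @ [b])" "successively E (a # L @ [b])" "3 \<le> length L"
    and "v0 \<notin> set (a # L @ [b])" "v1 \<notin> set (a # L @ [b])" "v2 \<notin> set (a # L @ [b])"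
    and "E a v0" "E v0 v1" "E v1 v2" "E v2 b" "\<not> E v0 v2" "v0 \<noteq> v2"
    and N0: "\<And>c. c \<in> set (a # L @ [b]) \<Longrightarrow> c \<noteq> a \<Longrightarrow> \<not> E v0 c"
    and N1: "\<And>c. c \<in> set (a # L @ [b]) \<Longrightarrow> \<not> E v1 c"
    and N2: "\<And>c. c \<in> set (a # L @ [b]) \<Longrightarrow> c \<noteq> b \<Longrightarrow> \<not> E v2 c"
  shows "\<exists>C. cyc C \<and> length C = length L + 3"
proof -
  note sym = E_sym[OF assms(7)] E_sym[OF assms(8)] E_sym[OF assms(9)] E_sym[OF assms(10)]
  have v: "v0 \<noteq> v1" "v1 \<noteq> v2" using assms(8,9) by auto
  obtain l1 l2 l3 L' where L: "L = l1 # l2 # l3 # L'"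
    using assms(3) by (metis Suc_le_length_iff numeral_3_eq_3)
  have nbr: "E a y" if "x \<in> set L" "y \<in> set L" "E a x" "E x y" for x y
  proof (rule ccontr)
    assume n: "\<not> E a y"
    have ne: "x \<noteq> a" "y \<noteq> a" "x \<noteq> b" "y \<noteq> b" "x \<noteq> y" "a \<noteq> b" using that assms(1) by auto
    have nv: "\<not> E v0 x" "\<not> E v0 y" "\<not> E v0 b" "\<not> E v1 x" "\<not> E v1 y" "\<not> E v1 a" "\<not> E v1 b"
       "\<not> E v2 x" "\<not> E v2 y" "\<not> E v2 a"
      using N0 N1 N2 that ne by auto
    show False
    proof (cases "E a b")
      case True
      have d: "distinct [v2, v1, v0, a, x, y]" using assms(4-6,12) that ne v by auto
      show False using P6_free[OF d] sym that n nv assms(11) E_commute by metis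
    next
      case False
      have d: "distinct [x, a, v0, v1, v2, b]" using assms(4-6,12) that ne v by auto
      \<comment> \<open>The ear with both ends, prolonged by \<open>x\<close>, forces
        \<open>x\<close> to be adjacent to \<open>b\<close>. The claw at \<open>x\<close> passes
        this on to \<open>y\<close>, and then the same path prolonged by \<open>y\<close> at the
        other end is induced.\<close>
      have xb: "E x b"
        using P6_free[OF d] assms(7-10) E_sym[OF that(3)] False nv assms(11) E_commute by metis
      then have yb: "E y b"
        using claw_free[of x a b y] E_sym[OF that(3)] that(4) n False ne E_commute by metis
      have d: "distinct [y, b, v2, v1, v0, a]" using assms(4-6,12) that ne v by auto
      show False using P6_free[OF d] sym yb n False nv assms(11) E_commute by metis
    qed
  qed
  have "E a l1" "E l1 l2" "E l2 l3" using assms(2) L by auto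
  then have "E a l3" using nbr[of l1 l2] nbr[of l2 l3] L by auto
  then have "cyc (a # l3 # L' @ [b, v2, v1, v0])"
    using assms(1,2,4-6,12) L sym v by (auto simp: cyc_def path_simps)
  then show ?thesis using L by fastforce
qed

text \<open>Three vertices must be bypassed. The ear with its two ends has six vertices, so
  \<open>a\<close> and \<open>b\<close> are adjacent. This edge closes the cycle when
  \<open>L\<close> has only three vertices; otherwise adjacency to \<open>a\<close> spreads as far
  as the fourth.\<close>

lemma ear4_cycle:
  assumes "distinct (a # L @ [b])" "successively E (a # L @ [b])" "3 \<le> length L"
    and "v0 \<notin> set (a # L @ [b])" "v1 \<notin> set (a # L @ [b])" "v2 \<notin> set (a # L @ [b])"
      "v3 \<notin> set (a # L @ [b])"
    and "E a v0" "E v0 v1" "E v1 v2" "E v2 v3" "E v3 b"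
    and "\<not> E v0 v2" "\<not> E v0 v3" "\<not> E v1 v3" "distinct [v0, v1, v2, v3]"
    and N0: "\<And>c. c \<in> set (a # L @ [b]) \<Longrightarrow> c \<noteq> a \<Longrightarrow> \<not> E v0 c"
    and N1: "\<And>c. c \<in> set (a # L @ [b]) \<Longrightarrow> \<not> E v1 c"
    and N2: "\<And>c. c \<in> set (a # L @ [b]) \<Longrightarrow> \<not> E v2 c"
    and N3: "\<And>c. c \<in> set (a # L @ [b]) \<Longrightarrow> c \<noteq> b \<Longrightarrow> \<not> E v3 c"
  shows "\<exists>C. cyc C \<and> length C = length L + 3"
proof -
  note sym = E_sym[OF assms(8)] E_sym[OF assms(9)] E_sym[OF assms(10)] E_sym[OF assms(11)]
    E_sym[OF assms(12)]
  obtain l1 l2 l3 L' where L: "L = l1 # l2 # l3 # L'"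
    using assms(3) by (metis Suc_le_length_iff numeral_3_eq_3)
  have ab: "E a b"
  proof (rule ccontr)
    assume n: "\<not> E a b"
    have d: "distinct [a, v0, v1, v2, v3, b]" using assms(1,4-7,16) by auto
    have "\<not> E v0 b" "\<not> E v1 a" "\<not> E v1 b" "\<not> E v2 a" "\<not> E v2 b" "\<not> E v3 a"
      using N0 N1 N2 N3 assms(1) by auto
    then show False using P6_free[OF d] assms(8-15) n E_commute by metis
  qed
  have nbr: "E a y" if "x \<in> set L" "y \<in> set L" "E a x" "E x y" for x y
  proof (rule ccontr)
    assume n: "\<not> E a y"
    have ne: "x \<noteq> a" "y \<noteq> a" "x \<noteq> b" "y \<noteq> b" "x \<noteq> y" "a \<noteq> b" using that assms(1) by auto
    have nv: "\<not> E v0 x" "\<not> E v0 y" "\<not> E v1 x" "\<not> E v1 y" "\<not> E v1 a" "\<not> E v2 x" "\<not> E v2 y" "\<not> E v2 a"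
      using N0 N1 N2 that ne by auto
    have d: "distinct [v2, v1, v0, a, x, y]" using assms(4-7,16) that ne by auto
    show False using P6_free[OF d] sym that n nv assms(13) E_commute by metis
  qed
  have e: "E a l1" "E l1 l2" "E l2 l3" using assms(2) L by auto
  then have a3: "E a l3" using nbr[of l1 l2] nbr[of l2 l3] L by auto
  have "cyc (a # L' @ [b, v3, v2, v1, v0])"
  proof (cases L')
    case Nil
    then show ?thesis using assms(1,4-7,16) ab sym by (auto simp: cyc_def)
  next
    case (Cons l4 L'')
    then have "E l3 l4" using assms(2) L by auto
    then have "E a l4" using nbr[of l3 l4] a3 L Cons by auto
    then show ?thesis using assms(1,2,4-7,16) L Cons sym by (auto simp: cyc_def path_simps)
  qed
  then show ?thesis using L by fastforce
qed

end

text \<open>2-connectedness is stated through cuts: after deleting at most one vertex, every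
  nonempty proper part of the rest has an edge leaving it. A set with no leaving edge is then a
  contradiction without any talk of paths.\<close>

locale two_connected_claw_P6_free = claw_P6_free +
  assumes two_connected: "\<lbrakk>X \<subseteq> V; card X < 2; S \<subseteq> V - X; S \<noteq> {}; S \<noteq> V - X\<rbrakk> \<Longrightarrow>
    \<exists>u\<in>S. \<exists>w\<in>V - X - S. E u w"
begin

text \<open>\<open>vs\<close> may repeat vertices. Pieces and shortcuts of an ear are thus ears
  without further checks, so minimality of the length applies to them at once.\<close>

definition ear :: "'a list \<Rightarrow> 'a list \<Rightarrow> 'a \<Rightarrow> 'a \<Rightarrow> bool" where
  "ear C vs a b \<longleftrightarrow> vs \<noteq> [] \<and> set vs \<inter> set C = {} \<and> successively E vs \<and>
     a \<in> set C \<and> b \<in> set C \<and> a \<noteq> b \<and> E a (hd vs) \<and> E (last vs) b"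

section \<open>Ears in a 2-connected graph and the extension step\<close>

lemma reach_avoiding:
  assumes "v \<in> V" "v \<notin> W" "a \<in> W" "t \<in> W" "t \<noteq> a" "W \<subseteq> V"
  obtains vs b where "vs \<noteq> []" "hd vs = v" "set vs \<inter> W = {}" "successively E vs" "distinct vs"
    "b \<in> W" "b \<noteq> a" "E (last vs) b"
proof -
  define R where "R = {w. \<exists>vs. vs \<noteq> [] \<and> hd vs = v \<and> last vs = w \<and> successively E vs \<and>
    distinct vs \<and> set vs \<inter> W = {} \<and> set vs \<subseteq> V}"
  have RW: "R \<subseteq> V - W" unfolding R_def by (auto dest: last_in_set)
  have "v \<in> R" unfolding R_def using assms(1,2) by (auto intro!: exI[of _ "[v]"])
  moreover have "t \<notin> R" using RW assms(4) by auto
  \<comment> \<open>Deleting \<open>a\<close> still leaves an edge out of \<open>R\<close>. Its end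
    cannot lie outside \<open>W\<close>, for it would then be reached as well; so it is the desired
    \<open>b\<close>.\<close>
  ultimately have "\<exists>u\<in>R. \<exists>w\<in>V - {a} - R. E u w"
    using RW assms by (intro two_connected) auto
  then obtain u w where u: "u \<in> R" and w: "w \<in> V" "w \<noteq> a" "w \<notin> R" "E u w" by auto
  obtain vs where vs: "vs \<noteq> []" "hd vs = v" "last vs = u" "successively E vs" "distinct vs"
    "set vs \<inter> W = {}" "set vs \<subseteq> V"
    using u unfolding R_def by blast
  have "w \<in> W"
  proof (rule ccontr)
    assume W: "w \<notin> W"
    have "w \<in> R"
    proof (cases "w \<in> set vs")
      case True
      then obtain X Y where "vs = X @ w # Y" by (meson split_list)
      then show ?thesis unfolding R_def using vs
        by (auto intro!: exI[of _ "X @ [w]"] simp: path_simps)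
    next
      case False
      then show ?thesis unfolding R_def using vs w W
        by (auto intro!: exI[of _ "vs @ [w]"] simp: path_simps)
    qed
    then show False using w by simp
  qed
  then show ?thesis using that vs w by blast
qed

lemma ear_exists:
  assumes "cyc C" "set C \<noteq> V"
  shows "\<exists>vs a b. ear C vs a b \<and> distinct vs"
proof -
  have V: "set C \<subseteq> V" using assms cyc_in_V by blast
  have ne: "set C \<noteq> {}" using assms(1) by (auto simp: cyc_def)
  obtain a v where a: "a \<in> set C" "v \<in> V" "v \<notin> set C" "E a v"
    using two_connected[of "{}" "set C"] V ne assms(2) by auto
  have "card (set C) \<ge> 3" using assms(1) by (auto simp: cyc_def distinct_card)
  then have "set C \<noteq> {a}" by auto
  then obtain t where t: "t \<in> set C" "t \<noteq> a" using a by auto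
  obtain vs b where "vs \<noteq> []" "hd vs = v" "set vs \<inter> set C = {}" "successively E vs" "distinct vs"
    "b \<in> set C" "b \<noteq> a" "E (last vs) b"
    using reach_avoiding[OF a(2,3,1) t V] by blast
  then show ?thesis using a unfolding ear_def by metis
qed

lemma shortest_ear:
  assumes "cyc C" "set C \<noteq> V"
  obtains vs a b where "ear C vs a b" "\<And>ws c d. ear C ws c d \<Longrightarrow> length vs \<le> length ws"
proof -
  define P where "P = (\<lambda>vs. \<exists>a b. ear C vs a b)"
  obtain ws where "P ws"
    using ear_exists[OF assms] P_def by auto
  then obtain vs where "P vs" "\<forall>ws. P ws \<longrightarrow> length vs \<le> length ws"
    using ex_has_least_nat[of P ws length] by blast
  then show ?thesis using that unfolding P_def by blast
qed

text \<open>An ear with one vertex is handled by \<open>insert_common_neighbour\<close>. For a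
  longer shortest ear, \<open>J\<close> allows the vertices of the cycle to be rearranged as a path
  from \<open>a\<close> to \<open>b\<close>, over which the ear lemma for that length
  applies.\<close>

lemma longer_cycle:
  assumes C: "cyc C" "5 \<le> length C" "set C \<noteq> V"
  shows "\<exists>C'. cyc C' \<and> length C' = Suc (length C)"
proof -
  obtain vs a b where ear: "ear C vs a b" and min: "\<And>ws c d. ear C ws c d \<Longrightarrow> length vs \<le> length ws"
    using shortest_ear[OF C(1,3)] by blast
  have ab: "a \<in> set C" "b \<in> set C" "a \<noteq> b" using ear by (auto simp: ear_def)
  obtain A B where AB: "cyc (a # A @ b # B)" and setC: "set (a # A @ b # B) = set C"
    and len: "length (a # A @ b # B) = length C"
    using cyc_split_at[OF C(1) ab] by metis
  have vsC: "set vs \<inter> set C = {}" "vs \<noteq> []" "E a (hd vs)" "E (last vs) b" "successively E vs"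
    using ear by (auto simp: ear_def)
  show ?thesis
  proof (cases "length vs = 1")
    case True
    then obtain v where vs: "vs = [v]" by (cases vs) auto
    obtain C' where C': "cyc C'" "set C' = insert v (set (a # A @ b # B))"
      using insert_common_neighbour[OF AB, of v] vsC vs setC E_commute by auto
    have "length C' = card (insert v (set C))" "length C = card (set C)"
      using C' setC C(1) by (metis cyc_def distinct_card)+
    then show ?thesis using C' vsC vs by auto
  next
    case False
    then have two: "2 \<le> length vs" using vsC(2) by (cases vs) (auto simp: Suc_le_eq)
    have hl: "hd vs \<notin> set C"
      "last vs \<notin> set C" using vsC by (meson disjoint_iff hd_in_set last_in_set)+
    have N0: "\<not> E (hd vs) c" if "c \<in> set C" "c \<noteq> a" for c
      using min[of "[hd vs]" a c] two that vsC ab hl by (auto simp: ear_def)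
    have Nz: "\<not> E (last vs) c" if "c \<in> set C" "c \<noteq> b" for c
      using min[of "[last vs]" c b] two that vsC ab hl E_sym[of "last vs" c] by (auto simp: ear_def)
    \<comment> \<open>\<open>hd vs\<close> has no neighbour on the cycle other than
      \<open>a\<close>, so a claw at \<open>a\<close> with \<open>hd vs\<close> as a leaf makes the
      neighbours of \<open>a\<close> on the cycle a clique; likewise at \<open>b\<close>.\<close>
    have cla: "E x y" if "x \<in> set C" "y \<in> set C" "E a x" "E a y" "x \<noteq> y" for x y
      using claw_free[of a "hd vs" x y] that N0[of x] N0[of y] vsC(3) hl E_irrefl by blast
    have clb: "E x y" if "x \<in> set C" "y \<in> set C" "E b x" "E b y" "x \<noteq> y" for x y
      using claw_free[of b "last vs" x y] that Nz[of x] Nz[of y] E_sym[OF vsC(4)] hl E_irrefl by blast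
    \<comment> \<open>A shortest ear has no shortcuts, so \<open>a\<close> followed by five inner
      vertices would be an induced path.\<close>
    have le4: "length vs \<le> 4"
    proof (rule ccontr)
      assume "\<not> ?thesis"
      then have "5 \<le> length vs" by simp
      then obtain v0 v1 v2 v3 v4 r where vs: "vs = v0 # v1 # v2 # v3 # v4 # r"
        by (auto simp: Suc_le_length_iff numeral_eq_Suc)
      let ?l = "last (v4 # r)"
      have e: "E a v0" "E v0 v1" "E v1 v2" "E v2 v3" "E v3 v4" "successively E (v4 # r)" "E ?l b"
        using vsC vs by auto
      have nC: "v0 \<notin> set C" "v1 \<notin> set C" "v2 \<notin> set C" "v3 \<notin> set C" "v4 \<notin> set C" "set r \<inter> set C = {}"
        using vsC vs by auto
      have suf: "\<not> E a v1" "\<not> E a v2" "\<not> E a v3" "\<not> E a v4"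
        using min[of "v1 # v2 # v3 # v4 # r" a b] min[of "v2 # v3 # v4 # r" a b]
          min[of "v3 # v4 # r" a b] min[of "v4 # r" a b] vs e nC ab by (auto simp: ear_def)
      have sk: "\<not> E v0 v2" "\<not> E v0 v3" "\<not> E v0 v4"  "\<not> E v1 v3" "\<not> E v1 v4" "\<not> E v2 v4"
        using min[of "v0 # v2 # v3 # v4 # r" a b] min[of "v0 # v3 # v4 # r" a b]
          min[of "v0 # v4 # r" a b] min[of "v0 # v1 # v3 # v4 # r" a b]
          min[of "v0 # v1 # v4 # r" a b] min[of "v0 # v1 # v2 # v4 # r" a b]
          vs e nC ab by (auto simp: ear_def)
      have "distinct [a, v0, v1, v2, v3, v4]"
        using e suf sk nC ab(1) E_commute by auto
      then show False using P6_free[of a v0 v1 v2 v3 v4] e suf sk by blast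
    qed
    have dist: "distinct (a # A @ b # B)" using AB by (simp add: cyc_def)
    have J: "E (hd A) (hd B)" if "A \<noteq> []" "B \<noteq> []"
    proof -
      let ?x = "hd A" and ?y = "hd B"
      have e: "E a ?x" "E b ?y" using AB that by (auto simp: cyc_def path_simps)
      have xy: "?x \<in> set A" "?y \<in> set B" using that by auto
      have xyC: "?x \<in> set C" "?y \<in> set C" using xy setC by auto
      have ne: "?x \<noteq> ?y" "?x \<noteq> a" "?x \<noteq> b" "?y \<noteq> a" "?y \<noteq> b" using xy dist by auto
      consider "E a b" | "E ?x b" | "E ?y a" | "\<not> E a b" "\<not> E ?x b" "\<not> E ?y a" by blast
      then show ?thesis
      proof cases
        case 1
        then have "E ?x b" using cla[of ?x b] xyC ab e ne by auto
        then show ?thesis using clb[of ?x ?y] xyC e ne E_commute by auto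
      next
        case 2
        then show ?thesis using clb[of ?x ?y] xyC e ne E_commute by auto
      next
        case 3
        then show ?thesis using cla[of ?x ?y] xyC e ne E_commute by auto
      next
        case 4
        \<comment> \<open>Now the ear must lie on an induced path: \<open>?x a v0 v1 b ?y\<close>,
          \<open>?x a v0 v1 v2 b\<close> or \<open>a v0 v1 v2 v3 b\<close>, according to its length.
          In the first, the only missing adjacency still possible is the one claimed; the other two
          are contradictions.\<close>
        have nx: "\<not> E (hd vs) ?x" "\<not> E (hd vs) ?y" "\<not> E (last vs) ?x" "\<not> E (last vs) ?y"
          "\<not> E (hd vs) b" "\<not> E (last vs) a"
          using N0 Nz xyC ne ab by auto
        show ?thesis
        proof (cases "length vs = 2")
          case True
          then obtain v0 v1 where vs: "vs = [v0, v1]" by (auto simp: length_Suc_conv numeral_eq_Suc)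
          have d: "distinct [?x, a, v0, v1, b, ?y]" using vs vsC xyC ab ne by auto
          have ev: "E a v0" "E v0 v1" "E v1 b" using vs vsC by auto
          show ?thesis
            using P6_free[OF d] ev e nx[unfolded vs, simplified] 4 E_commute by metis
        next
          case False
          have int: "\<not> E v c" if "vs = us @ v # ws" "us \<noteq> []" "ws \<noteq> []" "c \<in> set C" for us v ws c
          proof
            assume "E v c"
            then show False
            proof (cases "c = a")
              case True
              then have "ear C (v # ws) a b" using that vsC ab \<open>E v c\<close> E_sym[OF \<open>E v c\<close>]
                by (auto simp: ear_def path_simps split: if_splits)
              then show False using min[of "v # ws" a b] that by auto
            next
              case False
              then have "ear C (us @ [v]) a c" using that vsC ab \<open>E v c\<close> E_sym[OF \<open>E v c\<close>]
                by (auto simp: ear_def path_simps split: if_splits)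
              then show False using min[of "us @ [v]" a c] that by auto
            qed
          qed
          have "length vs = 3 \<or> length vs = 4" using two le4 False by linarith
          then obtain v0 v1 v2 ws where vs: "vs = v0 # v1 # v2 # ws" "length ws \<le> 1"
            by (auto simp: length_Suc_conv numeral_eq_Suc)
          have i1: "\<not> E v1 c" if "c \<in> set C" for c using int[of "[v0]" v1 "v2 # ws" c] vs that by auto
          have s02: "\<not> E v0 v2" "v0 \<noteq> v2"
            using min[of "v0 # v2 # ws" a b] min[of "v2 # ws" a b] vs vsC ab by (auto simp: ear_def)
          show ?thesis
          proof (cases ws)
            case Nil
            have d: "distinct [?x, a, v0, v1, v2, b]" using vs vsC xyC ab ne s02 by auto
            have ev: "E a v0" "E v0 v1" "E v1 v2" "E v2 b" using vs Nil vsC by auto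
            have nv: "\<not> E v0 ?x" "\<not> E v0 b" "\<not> E v1 a" "\<not> E v1 b" "\<not> E v1 ?x" "\<not> E v2 a" "\<not> E v2 ?x"
              using vs Nil nx i1 xyC ab by auto
            have "E ?x b"
              using P6_free[OF d] ev nv s02 e 4 E_commute by metis
            then show ?thesis using 4 by simp
          next
            case (Cons v3 ws')
            then have vs4: "vs = [v0, v1, v2, v3]" using vs by auto
            have i2: "\<not> E v2 c" if "c \<in> set C" for c
              using int[of "[v0,v1]" v2 "[v3]" c] vs4 that by auto
            have s: "\<not> E v0 v3" "\<not> E v1 v3" "v0 \<noteq> v3" "v1 \<noteq> v3"
              using min[of "[v0, v3]" a b] min[of "[v0, v1, v3]" a b] min[of "[v3]" a b]
                min[of "[v0, v3]" a b] vs4 vsC ab by (auto simp: ear_def)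
            have d: "distinct [a, v0, v1, v2, v3, b]" using vs4 vsC ab s s02 by auto
            have ev: "E a v0" "E v0 v1" "E v1 v2" "E v2 v3" "E v3 b" using vs4 vsC by auto
            have nv: "\<not> E v0 b" "\<not> E v1 a" "\<not> E v1 b" "\<not> E v2 a" "\<not> E v2 b" "\<not> E v3 a"
              using vs4 nx i1 i2 ab by auto
            show ?thesis
              using P6_free[OF d] ev nv s s02 4 E_commute by metis
          qed
        qed
      qed
    qed
    have "\<exists>L. distinct (a # L @ [b]) \<and> successively E (a # L @ [b]) \<and> set (a # L @ [b]) = set C \<and>
        length L + 2 = length C"
    proof (cases "A = [] \<or> B = []")
      case True
      then show ?thesis
      proof
        assume "A = []"
        then show ?thesis using AB setC len
          by (intro exI[of _ "rev B"]) (auto simp: cyc_def path_simps E_commute split: if_splits)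
      next
        assume "B = []"
        then show ?thesis using AB setC len
          by (intro exI[of _ "A"]) (auto simp: cyc_def path_simps E_commute split: if_splits)
      qed
    next
      case False
      \<comment> \<open>From \<open>a\<close> run through \<open>B\<close> backwards, cross the edge
        between \<open>hd B\<close> and \<open>hd A\<close>, and follow \<open>A\<close> to
        \<open>b\<close>.\<close>
      then show ?thesis using AB setC len J
        by (intro exI[of _ "rev B @ A"]) (auto simp: cyc_def path_simps E_commute)
    qed
    then obtain L where L: "distinct (a # L @ [b])" "successively E (a # L @ [b])"
      and LC: "set (a # L @ [b]) = set C" and lenL: "length L + 2 = length C" by blast
    have L3: "3 \<le> length L" using lenL C(2) by simp
    consider "length vs = 2" | "length vs = 3" | "length vs = 4" using two le4 by linarith
    then have "\<exists>C'. cyc C' \<and> length C' = length L + 3"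
    proof cases
      case 1
      then obtain v0 v1 where vs: "vs = [v0, v1]" by (auto simp: length_Suc_conv numeral_eq_Suc)
      have sub: "x \<in> set C" if "x \<in> set (L @ [b])" for x using that LC by auto
      have cl: "E x y" if "x \<in> set (L @ [b])" "y \<in> set (L @ [b])" "E a x" "E a y" "x \<noteq> y" for x y
        using cla[OF sub[OF that(1)] sub[OF that(2)]] that by blast
      have "v0 \<notin> set (a # L @ [b])" "v1 \<notin> set (a # L @ [b])"
        unfolding LC using vs vsC by auto
      moreover have "\<not> E v0 c" if "c \<in> set (a # L @ [b])" "c \<noteq> a" for c
        using that N0[of c] unfolding LC vs by simp
      moreover have "\<not> E v1 c" if "c \<in> set (a # L @ [b])" "c \<noteq> b" for c
        using that Nz[of c] unfolding LC vs by simp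
      ultimately show ?thesis
        using ear2_cycle[OF L L3, of v0 v1] vs vsC cl by simp
    next
      case 2
      then obtain v0 v1 v2 where vs: "vs = [v0, v1, v2]"
        by (auto simp: length_Suc_conv numeral_eq_Suc)
      have s02: "\<not> E v0 v2" "v0 \<noteq> v2"
        using min[of "[v0, v2]" a b] min[of "[v2]" a b] vs vsC ab by (auto simp: ear_def)
      have i1: "\<not> E v1 c" if "c \<in> set C" for c
        using min[of "[v0, v1]" a c] min[of "[v1, v2]" c b] vs vsC ab that E_sym[of v1 c]
          by (auto simp: ear_def)
      have "v0 \<notin> set (a # L @ [b])" "v1 \<notin> set (a # L @ [b])" "v2 \<notin> set (a # L @ [b])"
        unfolding LC using vs vsC by auto
      moreover have "\<not> E v0 c" if "c \<in> set (a # L @ [b])" "c \<noteq> a" for c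
        using that N0[of c] unfolding LC vs by simp
      moreover have "\<not> E v1 c" if "c \<in> set (a # L @ [b])" for c
        using that i1[of c] unfolding LC by simp
      moreover have "\<not> E v2 c" if "c \<in> set (a # L @ [b])" "c \<noteq> b" for c
        using that Nz[of c] unfolding LC vs by simp
      ultimately show ?thesis
        using ear3_cycle[OF L L3, of v0 v1 v2] vs vsC s02 by simp
    next
      case 3
      then obtain v0 v1 v2 v3 where vs: "vs = [v0, v1, v2, v3]"
        by (auto simp: length_Suc_conv numeral_eq_Suc)
      have s: "\<not> E v0 v2" "\<not> E v0 v3" "\<not> E v1 v3" "distinct vs"
        using min[of "[v0, v2, v3]" a b] min[of "[v2, v3]" a b] min[of "[v0, v3]" a b]
          min[of "[v0, v1, v3]" a b] min[of "[v3]" a b] vs vsC ab by (auto simp: ear_def)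
      have i1: "\<not> E v1 c" if "c \<in> set C" for c
        using min[of "[v0, v1]" a c] min[of "[v1, v2, v3]" c b] vs vsC ab that E_sym[of v1 c]
          E_sym[of v2 c] by (auto simp: ear_def)
      have i2: "\<not> E v2 c" if "c \<in> set C" for c
        using min[of "[v0, v1, v2]" a c] min[of "[v2, v3]" c b] vs vsC ab that E_sym[of v1 c]
          E_sym[of v2 c] by (auto simp: ear_def)
      have "v0 \<notin> set (a # L @ [b])" "v1 \<notin> set (a # L @ [b])" "v2 \<notin> set (a # L @ [b])"
        "v3 \<notin> set (a # L @ [b])"
        unfolding LC using vs vsC by auto
      moreover have "\<not> E v0 c" if "c \<in> set (a # L @ [b])" "c \<noteq> a" for c
        using that N0[of c] unfolding LC vs by simp
      moreover have "\<not> E v1 c" if "c \<in> set (a # L @ [b])" for c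
        using that i1[of c] unfolding LC by simp
      moreover have "\<not> E v2 c" if "c \<in> set (a # L @ [b])" for c
        using that i2[of c] unfolding LC by simp
      moreover have "\<not> E v3 c" if "c \<in> set (a # L @ [b])" "c \<noteq> b" for c
        using that Nz[of c] unfolding LC vs by simp
      ultimately show ?thesis
        using ear4_cycle[OF L L3, of v0 v1 v2 v3] vs vsC s by simp
    qed
    then show ?thesis using lenL by (simp add: eval_nat_numeral)
  qed
qed

lemma cycle_exists:
  assumes "3 \<le> card V"
  shows "\<exists>C. cyc C"
proof -
  obtain a where a: "a \<in> V" using assms by fastforce
  have "V \<noteq> {a}" using assms by auto
  then obtain b where b: "b \<in> V" "b \<noteq> a" "E a b"
    using two_connected[of "{}" "{a}"] a by auto
  have "card {a, b} = 2" using b by auto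
  then have "V \<noteq> {a, b}" using assms by auto
  then have "{a} \<noteq> V - {b}" using a b by auto
  then obtain c where c: "c \<in> V" "c \<noteq> b" "c \<noteq> a" "E a c"
    using two_connected[of "{b}" "{a}"] a b by auto
  obtain vs d where vs: "vs \<noteq> []" "hd vs = b" "set vs \<inter> {a, c} = {}" "successively E vs" "distinct vs"
    "d \<in> {a, c}" "d \<noteq> a" "E (last vs) d"
    using reach_avoiding[of b "{a, c}" a c] a b c by auto
  have "cyc (a # vs @ [c])"
    using vs a b c E_sym[OF c(4)] by (auto simp: cyc_def path_simps Suc_le_eq)
  then show ?thesis by blast
qed

lemma cycle_length_le: "cyc C \<Longrightarrow> length C \<le> card V"
  using cyc_in_V[of C] card_mono[OF finite_V, of "set C"] by (metis cyc_def distinct_card)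

text \<open>A longest cycle of length at most 4 could be enlarged: a one-vertex ear is absorbed, and
  a longer ear together with a nonempty arc has at least two ear vertices, two ends and one vertex
  of the arc.\<close>

lemma cycle_ge5_exists:
  assumes "5 \<le> card V"
  shows "\<exists>C. cyc C \<and> 5 \<le> length C"
proof -
  obtain C0 where "cyc C0" using cycle_exists assms by auto
  then obtain C where C: "cyc C" and max: "\<And>C'. cyc C' \<Longrightarrow> length C' \<le> length C"
    using ex_has_greatest_nat[of cyc C0 length "Suc (card V)"] cycle_length_le
    by (auto simp: less_Suc_eq_le)
  have "5 \<le> length C"
  proof (rule ccontr)
    assume short: "\<not> ?thesis"
    have lenC: "length C = card (set C)" using C by (metis cyc_def distinct_card)
    then have "set C \<noteq> V" using short assms by auto
    then obtain vs a b where ear: "ear C vs a b" "distinct vs" using ear_exists[OF C] by blast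
    then have ab: "a \<in> set C" "b \<in> set C" "a \<noteq> b" by (auto simp: ear_def)
    obtain A B where AB: "cyc (a # A @ b # B)" and setC: "set (a # A @ b # B) = set C"
      and len: "length (a # A @ b # B) = length C"
      using cyc_split_at[OF C ab] by metis
    have vs: "set vs \<inter> set (a # A @ b # B) = {}" "vs \<noteq> []" "E a (hd vs)" "E (last vs) b"
      "successively E vs"
      using ear setC by (auto simp: ear_def)
    note sym = E_sym[OF vs(3)] E_sym[OF vs(4)]
    show False
    proof (cases "length vs = 1")
      case True
      then obtain v where v: "vs = [v]" by (cases vs) auto
      have "v \<notin> set C" using vs(1) v setC by auto
      moreover obtain C' where C': "cyc C'" "set C' = insert v (set C)"
        using insert_common_neighbour[OF AB, of v] vs v setC sym by auto
      moreover have "length C' = card (set C')" using C' by (metis cyc_def distinct_card)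
      ultimately show False using max[OF C'(1)] lenC by simp
    next
      case False
      then have two: "2 \<le> length vs" using vs(2) by (cases vs) (auto simp: Suc_le_eq)
      have "3 \<le> length C" using C by (simp add: cyc_def)
      then consider "A \<noteq> []" | "B \<noteq> []" using len by (cases A; cases B) auto
      then show False
      proof cases
        case 1
        then have "cyc (a # A @ b # rev vs)"
          using AB vs two ear(2) sym by (auto simp: cyc_def path_simps E_commute split: if_splits)
        from max[OF this] 1 short two show False by (cases A) auto
      next
        case 2
        then have "cyc (b # B @ a # vs)"
          using AB vs two ear(2) sym by (auto simp: cyc_def path_simps E_commute split: if_splits)
        from max[OF this] 2 short two show False by (cases B) auto
      qed
    qed
  qed
  then show ?thesis using C by blast
qed

text \<open>\<open>Z\<close> with all its neighbours is a set with no leaving edge, so by the case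
  of no deleted vertex it is everything.\<close>

lemma dominating_if_no_distance_two:
  assumes "Z \<subseteq> V" "Z \<noteq> {}"
    and "\<And>z w u. z \<in> Z \<Longrightarrow> w \<notin> Z \<Longrightarrow> E w z \<Longrightarrow> E w u \<Longrightarrow> u \<notin> Z \<Longrightarrow> \<exists>z\<in>Z. E u z"
    and "v \<in> V" "v \<notin> Z"
  shows "\<exists>z\<in>Z. E v z"
proof (rule ccontr)
  assume no: "\<not> ?thesis"
  define S where "S = Z \<union> {w \<in> V. \<exists>z\<in>Z. E w z}"
  have "v \<notin> S" using no assms(5) S_def by auto
  then have "\<exists>u\<in>S. \<exists>w\<in>V - {} - S. E u w"
    using assms(1,2,4) by (intro two_connected) (auto simp: S_def)
  then obtain u w where "u \<in> S" "w \<in> V" "w \<notin> S" "E u w" by auto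
  then show False using assms(3)[of _ u w] E_sym unfolding S_def by blast
qed

end

section \<open>Attachments to induced cycles\<close>

lemma card_le_1_if:
  assumes "\<And>x y. x \<in> A \<Longrightarrow> y \<in> A \<Longrightarrow> x = y"
  shows "card A \<le> 1"
proof (cases "A = {}")
  case False
  then obtain x where "x \<in> A" by blast
  then have "A \<subseteq> {x}" using assms by blast
  then show ?thesis using card_mono[of "{x}" A] by simp
qed simp

lemma card_le_2_if:
  assumes "\<And>x y z. x \<in> A \<Longrightarrow> y \<in> A \<Longrightarrow> z \<in> A \<Longrightarrow> x \<noteq> y \<Longrightarrow> x \<noteq> z \<Longrightarrow> y \<noteq> z \<Longrightarrow> False"
  shows "card A \<le> 2"
proof (rule ccontr)
  assume "\<not> ?thesis"
  then obtain B where "B \<subseteq> A" "card B = 3"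
    by (metis not_less_eq_eq numeral_2_eq_2 numeral_3_eq_3 obtain_subset_with_card_n)
  then show False using assms by (auto simp: card_3_iff)
qed

context claw_P6_free
begin

definition ind4 :: "'a \<Rightarrow> 'a \<Rightarrow> 'a \<Rightarrow> 'a \<Rightarrow> bool" where
  "ind4 a b c d \<longleftrightarrow> distinct [a, b, c, d] \<and> E a b \<and> E b c \<and> E c d \<and> E d a \<and> \<not> E a c \<and> \<not> E b d"

definition ind5 :: "'a \<Rightarrow> 'a \<Rightarrow> 'a \<Rightarrow> 'a \<Rightarrow> 'a \<Rightarrow> bool" where
  "ind5 a b c d e \<longleftrightarrow> distinct [a, b, c, d, e] \<and> E a b \<and> E b c \<and> E c d \<and> E d e \<and> E e a \<and>
     \<not> E a c \<and> \<not> E a d \<and> \<not> E b d \<and> \<not> E b e \<and> \<not> E c e"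

definition ind6 :: "'a \<Rightarrow> 'a \<Rightarrow> 'a \<Rightarrow> 'a \<Rightarrow> 'a \<Rightarrow> 'a \<Rightarrow> bool" where
  "ind6 a b c d e f \<longleftrightarrow> distinct [a, b, c, d, e, f] \<and>
     E a b \<and> E b c \<and> E c d \<and> E d e \<and> E e f \<and> E f a \<and>
     \<not> E a c \<and> \<not> E a d \<and> \<not> E a e \<and> \<not> E b d \<and> \<not> E b e \<and> \<not> E b f \<and> \<not> E c e \<and> \<not> E c f \<and> \<not> E d f"

text \<open>The kinds of attachment: the orders are bounded by counting outside vertices separately
  for each set \<open>A\<close> of neighbours on the cycle.\<close>

definition attached :: "'a set \<Rightarrow> 'a set \<Rightarrow> 'a set" where
  "attached Z A = {w \<in> V - Z. \<forall>z\<in>Z. E w z \<longleftrightarrow> z \<in> A}"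

lemma finite_attached: "finite (attached Z A)"
  using finite_V by (simp add: attached_def)

lemma ind4_rotate: "ind4 a b c d \<Longrightarrow> ind4 b c d a"
  using E_commute by (auto simp: ind4_def)

lemma ind5_rotate: "ind5 a b c d e \<Longrightarrow> ind5 b c d e a"
  using E_commute by (auto simp: ind5_def)

lemma ind6_rotate: "ind6 a b c d e f \<Longrightarrow> ind6 b c d e f a"
  using E_commute by (auto simp: ind6_def)

text \<open>Meant for consecutive vertices \<open>y\<close>, \<open>z\<close>, \<open>x\<close> of
  an induced cycle: a vertex attached at \<open>z\<close> is also attached next to
  \<open>z\<close>.\<close>

lemma cycle_claw:
  assumes "E z y" "E z x" "y \<noteq> x" "\<not> E y x" "E w z" "w \<noteq> y" "w \<noteq> x"
  shows "E w y \<or> E w x"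
  using claw_free[of z w y x] assms E_sym by metis

text \<open>Otherwise \<open>w b c d e f\<close> is an induced path.\<close>

lemma ind6_edge:
  assumes "ind6 a b c d e f" "w \<notin> {a, b, c, d, e, f}" "E w a" "E w b"
  shows "E w c \<or> E w d \<or> E w e \<or> E w f"
  using P6_free[of w b c d e f] assms by (auto simp: ind6_def)

lemma ind6_neighbours:
  assumes I: "ind6 a b c d e f" and w: "w \<notin> {a, b, c, d, e, f}"
  shows "E w a \<Longrightarrow> E w b \<or> E w f" "E w b \<Longrightarrow> E w c \<or> E w a" "E w c \<Longrightarrow> E w d \<or> E w b"
    "E w d \<Longrightarrow> E w e \<or> E w c" "E w e \<Longrightarrow> E w f \<or> E w d" "E w f \<Longrightarrow> E w a \<or> E w e"
  using cycle_claw[of a b f w] cycle_claw[of b c a w] cycle_claw[of c d b w] cycle_claw[of d e c w]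
    cycle_claw[of e f d w] cycle_claw[of f a e w] I w E_commute
  unfolding ind6_def by (metis distinct_length_2_or_more insertCI)+

lemma ind6_edges:
  assumes I: "ind6 a b c d e f" and w: "w \<notin> {a, b, c, d, e, f}"
  shows "E w a \<Longrightarrow> E w b \<Longrightarrow> E w c \<or> E w d \<or> E w e \<or> E w f"
    "E w b \<Longrightarrow> E w c \<Longrightarrow> E w d \<or> E w e \<or> E w f \<or> E w a"
    "E w c \<Longrightarrow> E w d \<Longrightarrow> E w e \<or> E w f \<or> E w a \<or> E w b"
    "E w d \<Longrightarrow> E w e \<Longrightarrow> E w f \<or> E w a \<or> E w b \<or> E w c"
    "E w e \<Longrightarrow> E w f \<Longrightarrow> E w a \<or> E w b \<or> E w c \<or> E w d"
    "E w f \<Longrightarrow> E w a \<Longrightarrow> E w b \<or> E w c \<or> E w d \<or> E w e"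
  using ind6_edge[of a b c d e f w] ind6_edge[of b c d e f a w] ind6_edge[of c d e f a b w]
    ind6_edge[of d e f a b c w] ind6_edge[of e f a b c d w] ind6_edge[of f a b c d e w]
    I ind6_rotate w by (simp_all add: insert_commute)

lemma ind5_neighbours:
  assumes I: "ind5 a b c d e" and w: "w \<notin> {a, b, c, d, e}"
  shows "E w a \<Longrightarrow> E w b \<or> E w e" "E w b \<Longrightarrow> E w c \<or> E w a" "E w c \<Longrightarrow> E w d \<or> E w b"
    "E w d \<Longrightarrow> E w e \<or> E w c" "E w e \<Longrightarrow> E w a \<or> E w d"
  using cycle_claw[of a b e w] cycle_claw[of b c a w] cycle_claw[of c d b w] cycle_claw[of d e c w]
    cycle_claw[of e a d w] I w E_commute
  unfolding ind5_def by (metis distinct_length_2_or_more insertCI)+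

lemma ind4_neighbours:
  assumes I: "ind4 a b c d" and w: "w \<notin> {a, b, c, d}"
  shows "E w a \<Longrightarrow> E w b \<or> E w d" "E w b \<Longrightarrow> E w c \<or> E w a" "E w c \<Longrightarrow> E w d \<or> E w b"
    "E w d \<Longrightarrow> E w a \<or> E w c"
  using cycle_claw[of a b d w] cycle_claw[of b c a w] cycle_claw[of c d b w] cycle_claw[of d a c w]
    I w E_commute
  unfolding ind4_def by (metis distinct_length_2_or_more insertCI)+

text \<open>A claw at \<open>w\<close> with the nonadjacent leaves \<open>x\<close>,
  \<open>y\<close>. A vertex with two nonadjacent neighbours in \<open>Z\<close> therefore never
  leads to distance two from \<open>Z\<close>.\<close>

lemma attached_opposite_no_distance_two:
  assumes "w \<in> attached Z A" "x \<in> A" "y \<in> A" "A \<subseteq> Z" "x \<noteq> y" "\<not> E x y" "E w u" "u \<notin> Z"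
  shows "\<exists>z\<in>Z. E u z"
proof -
  have "E w x" "E w y" "u \<noteq> x" "u \<noteq> y" using assms by (auto simp: attached_def)
  then have "E u x \<or> E u y" using claw_free[of w u x y] assms(5-7) by auto
  then show ?thesis using assms(2-4) by auto
qed

text \<open>Up to rotation and reflection, \<open>a c\<close> is the only chord of a 5-cycle. The
  5-cycle may have further chords.\<close>

definition house_free :: bool where
  "house_free \<longleftrightarrow> (\<forall>a b c d e. distinct [a, b, c, d, e] \<longrightarrow> E a b \<longrightarrow> E b c \<longrightarrow> E c d \<longrightarrow> E d e \<longrightarrow>
     E e a \<longrightarrow> \<not> E a c)"

definition diamond_free :: bool where
  "diamond_free \<longleftrightarrow> (\<forall>a b c d. distinct [a, b, c, d] \<longrightarrow> E a b \<longrightarrow> E b c \<longrightarrow> E c d \<longrightarrow> E d a \<longrightarrow> \<not> E a c)"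

lemma house_freeD:
  "\<lbrakk>house_free; distinct [a, b, c, d, e]; E a b; E b c; E c d; E d e; E e a; E a c\<rbrakk> \<Longrightarrow> False"
  unfolding house_free_def by blast

lemma diamond_freeD:
  "\<lbrakk>diamond_free; distinct [a, b, c, d]; E a b; E b c; E c d; E d a; E a c\<rbrakk> \<Longrightarrow> False"
  unfolding diamond_free_def by blast

text \<open>Up to symmetry a 6-cycle has two chords, the short one \<open>a c\<close> and the long
  one \<open>a d\<close>.\<close>

definition chorded_C6_free :: bool where
  "chorded_C6_free \<longleftrightarrow> (\<forall>a b c d e f. distinct [a, b, c, d, e, f] \<longrightarrow> E a b \<longrightarrow> E b c \<longrightarrow> E c d \<longrightarrow>
     E d e \<longrightarrow> E e f \<longrightarrow> E f a \<longrightarrow> \<not> E a c \<and> \<not> E a d)"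

lemma chorded_C6_freeD:
  "\<lbrakk>chorded_C6_free; distinct [a, b, c, d, e, f]; E a b; E b c; E c d; E d e; E e f; E f a; E a c
    \<or> E a d\<rbrakk>
    \<Longrightarrow> False"
  unfolding chorded_C6_free_def by blast

section \<open>How often a kind of attachment occurs\<close>

lemma ind6_triple_le_1:
  assumes H: "house_free" and I: "ind6 a b c d e f"
  shows "card (attached {a, b, c, d, e, f} {a, b, c}) \<le> 1"
proof (rule card_le_1_if, rule ccontr)
  fix x y assume xy: "x \<in> attached {a, b, c, d, e, f} {a, b, c}"
    "y \<in> attached {a, b, c, d, e, f} {a, b, c}" "x \<noteq> y"
  \<comment> \<open>Two such vertices give the 5-cycle \<open>b x a y c\<close> with chord
    \<open>a b\<close>.\<close>
  then have "E x a" "E x b" "E x c" "E y a" "E y b" "E y c" "distinct [b, x, a, y, c]"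
    using I by (auto simp: ind6_def attached_def)
  then show False
    using house_freeD[OF H, of b x a y c] I E_commute unfolding ind6_def by metis
qed

lemma ind5_triple_le_1:
  assumes H: "house_free" and I: "ind5 a b c d e"
  shows "card (attached {a, b, c, d, e} {a, b, c}) \<le> 1"
proof (rule card_le_1_if, rule ccontr)
  fix x y assume xy: "x \<in> attached {a, b, c, d, e} {a, b, c}"
    "y \<in> attached {a, b, c, d, e} {a, b, c}" "x \<noteq> y"
  then have "E x a" "E x b" "E x c" "E y a" "E y b" "E y c" "distinct [b, x, a, y, c]"
    using I by (auto simp: ind5_def attached_def)
  then show False
    using house_freeD[OF H, of b x a y c] I E_commute unfolding ind5_def by metis
qed

text \<open>The claw at \<open>a\<close> with leaf \<open>e\<close> makes these vertices pairwise
  adjacent, and three of them give the 5-cycle \<open>a b x y z\<close> with chord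
  \<open>a x\<close>.\<close>

lemma ind5_edge_le_2:
  assumes H: "house_free" and I: "ind5 a b c d e"
  shows "card (attached {a, b, c, d, e} {a, b}) \<le> 2"
proof (rule card_le_2_if)
  let ?K = "attached {a, b, c, d, e} {a, b}"
  have adj: "E x y" if "x \<in> ?K" "y \<in> ?K" "x \<noteq> y" for x y
  proof -
    have "E a x" "E a y" "E a e" "\<not> E x e" "\<not> E y e" "x \<noteq> e" "y \<noteq> e"
      using that I E_commute by (auto simp: ind5_def attached_def)
    then show ?thesis using claw_free[of a e x y] that(3) E_commute by metis
  qed
  fix x y z assume xyz: "x \<in> ?K" "y \<in> ?K" "z \<in> ?K" "x \<noteq> y" "x \<noteq> z" "y \<noteq> z"
  then have "E x y" "E y z" using adj by auto
  moreover have "E x a" "E z a" "E x b" "distinct [a, b, x, y, z]" "E a b"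
    using xyz I by (auto simp: ind5_def attached_def)
  ultimately show False using house_freeD[OF H, of a b x y z] E_commute by metis
qed

text \<open>If \<open>x\<close> and \<open>y\<close> are adjacent, the 5-cycle
  \<open>x a b c y\<close> has the chord \<open>x b\<close>; if not, going round the other side,
  \<open>x a e d c y\<close> is an induced path.\<close>

lemma ind5_adjacent_edges:
  assumes H: "house_free" and I: "ind5 a b c d e"
  shows "attached {a, b, c, d, e} {a, b} = {} \<or> attached {a, b, c, d, e} {b, c} = {}"
proof (rule ccontr)
  assume "\<not> ?thesis"
  then obtain x y where "x \<in> attached {a, b, c, d, e} {a, b}" "y \<in> attached {a, b, c, d, e} {b, c}"
    by blast
  then have e: "E x a" "E x b" "\<not> E x c" "\<not> E x d" "\<not> E x e" "E y b" "E y c" "\<not> E y a" "\<not> E y d"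
    "\<not> E y e"
    and d: "distinct [x, a, e, d, c, y]" and d': "distinct [x, a, b, c, y]"
    using I by (auto simp: ind5_def attached_def)
  have "\<not> E x y"
  proof
    assume "E x y"
    then show False
      using house_freeD[OF H d'] I e E_commute unfolding ind5_def by metis
  qed
  then show False
    using P6_free[OF d] I e E_commute unfolding ind5_def by metis
qed

text \<open>The 5-cycle \<open>b y c x a\<close> would have the chord \<open>b c\<close>.\<close>

lemma ind5_adjacent_triples:
  assumes H: "house_free" and I: "ind5 a b c d e"
  shows "attached {a, b, c, d, e} {a, b, c} = {} \<or> attached {a, b, c, d, e} {b, c, d} = {}"
proof (rule ccontr)
  assume "\<not> ?thesis"
  then obtain x y where "x \<in> attached {a, b, c, d, e} {a, b, c}"
    "y \<in> attached {a, b, c, d, e} {b, c, d}"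
    by blast
  then have e: "E x a" "E x b" "E x c" "E y b" "E y c" "\<not> E x d" "E y d"
    and d: "distinct [b, y, c, x, a]"
    using I by (auto simp: ind5_def attached_def)
  then show False
    using house_freeD[OF H d] I e E_commute unfolding ind5_def by metis
qed

section \<open>Which kinds of attachment are possible\<close>

lemma house_free_attachment:
  assumes H: "house_free" and "E p q" "E q r" "E r s" "distinct [p, q, r, s]" "w \<notin> {p, q, r, s}"
  shows "\<not> (E w p \<and> E w s \<and> (E w q \<or> E w r))"
  using house_freeD[OF H, of w p q r s] house_freeD[OF H, of w s r q p] assms(2-) E_commute
  by auto

lemma diamond_free_attachment:
  assumes H: "diamond_free" and "E p q" "E q r" "distinct [p, q, r]" "w \<notin> {p, q, r}"
  shows "\<not> (E w p \<and> E w q \<and> E w r)"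
  using diamond_freeD[OF H, of w p q r] assms(2-) E_commute by auto

lemma chorded_C6_free_attachment:
  assumes H: "chorded_C6_free" and "E p q" "E q r" "E r s" "E s t" "distinct [p, q, r, s, t]"
    "w \<notin> {p, q, r, s, t}"
  shows "\<not> (E w p \<and> E w t \<and> (E w q \<or> E w r \<or> E w s))"
  using chorded_C6_freeD[OF H, of w p q r s t] chorded_C6_freeD[OF H, of w t s r q p] assms(2-)
    E_commute
  by auto

text \<open>Isolated neighbours are excluded by claws, a single edge by an induced path. Two
  opposite vertices of the cycle are the ends of a four-vertex path, so they cannot both be
  neighbours together with a vertex between them. Only three consecutive neighbours remain.\<close>

lemma ind6_house_cover:
  assumes H: "house_free" and I: "ind6 a b c d e f" and w: "w \<in> V" "w \<notin> {a, b, c, d, e, f}"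
    and nbr: "\<exists>z\<in>{a, b, c, d, e, f}. E w z"
  shows "\<exists>A\<in>set [{a, b, c}, {b, c, d}, {c, d, e}, {d, e, f}, {e, f, a},
    {f, a, b}]. w \<in> attached {a, b, c, d, e, f} A"
proof -
  have h: "\<not> (E w a \<and> E w d \<and> (E w b \<or> E w c))" "\<not> (E w b \<and> E w e \<and> (E w c \<or> E w d))"
    "\<not> (E w c \<and> E w f \<and> (E w d \<or> E w e))" "\<not> (E w d \<and> E w a \<and> (E w e \<or> E w f))"
    "\<not> (E w e \<and> E w b \<and> (E w f \<or> E w a))" "\<not> (E w f \<and> E w c \<and> (E w a \<or> E w b))"
    by ((rule house_free_attachment[OF H]; use I w in \<open>auto simp: ind6_def\<close>)+)
  have "E w a \<or> E w b \<or> E w c \<or> E w d \<or> E w e \<or> E w f"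
    using nbr by simp
  then have "(E w a \<and> E w b \<and> E w c \<and> \<not> E w d \<and> \<not> E w e \<and> \<not> E w f) \<or>
    (\<not> E w a \<and> E w b \<and> E w c \<and> E w d \<and> \<not> E w e \<and> \<not> E w f) \<or>
    (\<not> E w a \<and> \<not> E w b \<and> E w c \<and> E w d \<and> E w e \<and> \<not> E w f) \<or>
    (\<not> E w a \<and> \<not> E w b \<and> \<not> E w c \<and> E w d \<and> E w e \<and> E w f) \<or>
    (E w a \<and> \<not> E w b \<and> \<not> E w c \<and> \<not> E w d \<and> E w e \<and> E w f) \<or>
    (E w a \<and> E w b \<and> \<not> E w c \<and> \<not> E w d \<and> \<not> E w e \<and> E w f)"
    using ind6_neighbours[OF I w(2)] ind6_edges[OF I w(2)] h by satx
  then show ?thesis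
    using I w unfolding attached_def ind6_def by (elim disjE) auto
qed

lemma ind5_house_cover:
  assumes H: "house_free" and I: "ind5 a b c d e" and w: "w \<in> V" "w \<notin> {a, b, c, d, e}"
    and nbr: "\<exists>z\<in>{a, b, c, d, e}. E w z"
  shows "\<exists>A\<in>set [{a, b}, {b, c}, {c, d}, {d, e}, {e, a}, {a, b, c}, {b, c, d}, {c, d, e},
    {d, e, a}, {e, a, b}]. w \<in> attached {a, b, c, d, e} A"
proof -
  have h: "\<not> (E w a \<and> E w d \<and> (E w b \<or> E w c))" "\<not> (E w b \<and> E w e \<and> (E w c \<or> E w d))"
    "\<not> (E w c \<and> E w a \<and> (E w d \<or> E w e))" "\<not> (E w d \<and> E w b \<and> (E w e \<or> E w a))"
    "\<not> (E w e \<and> E w c \<and> (E w a \<or> E w b))"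
    by ((rule house_free_attachment[OF H]; use I w in \<open>auto simp: ind5_def\<close>)+)
  have "E w a \<or> E w b \<or> E w c \<or> E w d \<or> E w e"
    using nbr by simp
  then have "(E w a \<and> E w b \<and> \<not> E w c \<and> \<not> E w d \<and> \<not> E w e) \<or>
    (\<not> E w a \<and> E w b \<and> E w c \<and> \<not> E w d \<and> \<not> E w e) \<or>
    (\<not> E w a \<and> \<not> E w b \<and> E w c \<and> E w d \<and> \<not> E w e) \<or>
    (\<not> E w a \<and> \<not> E w b \<and> \<not> E w c \<and> E w d \<and> E w e) \<or>
    (E w a \<and> \<not> E w b \<and> \<not> E w c \<and> \<not> E w d \<and> E w e) \<or>
    (E w a \<and> E w b \<and> E w c \<and> \<not> E w d \<and> \<not> E w e) \<or>
    (\<not> E w a \<and> E w b \<and> E w c \<and> E w d \<and> \<not> E w e) \<or>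
    (\<not> E w a \<and> \<not> E w b \<and> E w c \<and> E w d \<and> E w e) \<or>
    (E w a \<and> \<not> E w b \<and> \<not> E w c \<and> E w d \<and> E w e) \<or>
    (E w a \<and> E w b \<and> \<not> E w c \<and> \<not> E w d \<and> E w e)"
    using ind5_neighbours[OF I w(2)] h by satx
  then show ?thesis
    using I w unfolding attached_def ind5_def by (elim disjE) auto
qed

text \<open>Neighbours come in consecutive pairs but never three in a row, and a single pair is
  excluded by an induced path; what is left is a pair of opposite edges.\<close>

lemma ind6_diamond_cover:
  assumes H: "diamond_free" and I: "ind6 a b c d e f" and w: "w \<in> V" "w \<notin> {a, b, c, d, e, f}"
    and nbr: "\<exists>z\<in>{a, b, c, d, e, f}. E w z"
  shows "\<exists>A\<in>set [{a, b, d, e}, {b, c, e, f}, {c, d, f, a}]. w \<in> attached {a, b, c, d, e, f} A"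
proof -
  have h: "\<not> (E w a \<and> E w b \<and> E w c)" "\<not> (E w b \<and> E w c \<and> E w d)" "\<not> (E w c \<and> E w d \<and> E w e)"
    "\<not> (E w d \<and> E w e \<and> E w f)" "\<not> (E w e \<and> E w f \<and> E w a)" "\<not> (E w f \<and> E w a \<and> E w b)"
    by ((rule diamond_free_attachment[OF H]; use I w in \<open>auto simp: ind6_def\<close>)+)
  have "E w a \<or> E w b \<or> E w c \<or> E w d \<or> E w e \<or> E w f"
    using nbr by simp
  then have "(E w a \<and> E w b \<and> \<not> E w c \<and> E w d \<and> E w e \<and> \<not> E w f) \<or>
    (\<not> E w a \<and> E w b \<and> E w c \<and> \<not> E w d \<and> E w e \<and> E w f) \<or>
    (E w a \<and> \<not> E w b \<and> E w c \<and> E w d \<and> \<not> E w e \<and> E w f)"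
    using ind6_neighbours[OF I w(2)] ind6_edges[OF I w(2)] h by satx
  then show ?thesis
    using I w unfolding attached_def ind6_def by (elim disjE) auto
qed

lemma ind5_diamond_cover:
  assumes H: "diamond_free" and I: "ind5 a b c d e" and w: "w \<in> V" "w \<notin> {a, b, c, d, e}"
    and nbr: "\<exists>z\<in>{a, b, c, d, e}. E w z"
  shows "\<exists>A\<in>set [{a, b}, {b, c}, {c, d}, {d, e}, {e, a}]. w \<in> attached {a, b, c, d, e} A"
proof -
  have h: "\<not> (E w a \<and> E w b \<and> E w c)" "\<not> (E w b \<and> E w c \<and> E w d)" "\<not> (E w c \<and> E w d \<and> E w e)"
    "\<not> (E w d \<and> E w e \<and> E w a)" "\<not> (E w e \<and> E w a \<and> E w b)"
    by ((rule diamond_free_attachment[OF H]; use I w in \<open>auto simp: ind5_def\<close>)+)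
  have "E w a \<or> E w b \<or> E w c \<or> E w d \<or> E w e"
    using nbr by simp
  then have "(E w a \<and> E w b \<and> \<not> E w c \<and> \<not> E w d \<and> \<not> E w e) \<or>
    (\<not> E w a \<and> E w b \<and> E w c \<and> \<not> E w d \<and> \<not> E w e) \<or>
    (\<not> E w a \<and> \<not> E w b \<and> E w c \<and> E w d \<and> \<not> E w e) \<or>
    (\<not> E w a \<and> \<not> E w b \<and> \<not> E w c \<and> E w d \<and> E w e) \<or>
    (E w a \<and> \<not> E w b \<and> \<not> E w c \<and> \<not> E w d \<and> E w e)"
    using ind5_neighbours[OF I w(2)] h by satx
  then show ?thesis
    using I w unfolding attached_def ind5_def by (elim disjE) auto
qed

lemma ind4_diamond_cover:
  assumes H: "diamond_free" and I: "ind4 a b c d" and w: "w \<in> V" "w \<notin> {a, b, c, d}"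
    and nbr: "\<exists>z\<in>{a, b, c, d}. E w z"
  shows "\<exists>A\<in>set [{a, b}, {b, c}, {c, d}, {d, a}]. w \<in> attached {a, b, c, d} A"
proof -
  have h: "\<not> (E w a \<and> E w b \<and> E w c)" "\<not> (E w b \<and> E w c \<and> E w d)" "\<not> (E w c \<and> E w d \<and> E w a)"
    "\<not> (E w d \<and> E w a \<and> E w b)"
    by ((rule diamond_free_attachment[OF H]; use I w in \<open>auto simp: ind4_def\<close>)+)
  have "E w a \<or> E w b \<or> E w c \<or> E w d"
    using nbr by simp
  then have "(E w a \<and> E w b \<and> \<not> E w c \<and> \<not> E w d) \<or>
    (\<not> E w a \<and> E w b \<and> E w c \<and> \<not> E w d) \<or>
    (\<not> E w a \<and> \<not> E w b \<and> E w c \<and> E w d) \<or>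
    (E w a \<and> \<not> E w b \<and> \<not> E w c \<and> E w d)"
    using ind4_neighbours[OF I w(2)] h by satx
  then show ?thesis
    using I w unfolding attached_def ind4_def by (elim disjE) auto
qed

text \<open>Two cycle vertices with a common cycle neighbour are also the ends of the five-vertex
  path around the other side. If \<open>w\<close> sees both, it closes a 6-cycle with that path and
  hence sees none of its inner vertices.\<close>

lemma ind6_chorded_C6_cover:
  assumes H: "chorded_C6_free" and I: "ind6 a b c d e f" and w: "w \<in> V" "w \<notin> {a, b, c, d, e, f}"
    and nbr: "\<exists>z\<in>{a, b, c, d, e, f}. E w z"
  shows "\<exists>A\<in>set [{a, b, c}, {b, c, d}, {c, d, e}, {d, e, f}, {e, f, a},
    {f, a, b}]. w \<in> attached {a, b, c, d, e, f} A"
proof -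
  have h: "\<not> (E w a \<and> E w e \<and> (E w b \<or> E w c \<or> E w d))"
    "\<not> (E w b \<and> E w f \<and> (E w c \<or> E w d \<or> E w e))" "\<not> (E w c \<and> E w a \<and> (E w d \<or> E w e \<or> E w f))"
    "\<not> (E w d \<and> E w b \<and> (E w e \<or> E w f \<or> E w a))" "\<not> (E w e \<and> E w c \<and> (E w f \<or> E w a \<or> E w b))"
    "\<not> (E w f \<and> E w d \<and> (E w a \<or> E w b \<or> E w c))"
    by ((rule chorded_C6_free_attachment[OF H]; use I w in \<open>auto simp: ind6_def\<close>)+)
  have "E w a \<or> E w b \<or> E w c \<or> E w d \<or> E w e \<or> E w f"
    using nbr by simp
  then have "(E w a \<and> E w b \<and> E w c \<and> \<not> E w d \<and> \<not> E w e \<and> \<not> E w f) \<or>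
    (\<not> E w a \<and> E w b \<and> E w c \<and> E w d \<and> \<not> E w e \<and> \<not> E w f) \<or>
    (\<not> E w a \<and> \<not> E w b \<and> E w c \<and> E w d \<and> E w e \<and> \<not> E w f) \<or>
    (\<not> E w a \<and> \<not> E w b \<and> \<not> E w c \<and> E w d \<and> E w e \<and> E w f) \<or>
    (E w a \<and> \<not> E w b \<and> \<not> E w c \<and> \<not> E w d \<and> E w e \<and> E w f) \<or>
    (E w a \<and> E w b \<and> \<not> E w c \<and> \<not> E w d \<and> \<not> E w e \<and> E w f)"
    using ind6_neighbours[OF I w(2)] ind6_edges[OF I w(2)] h by satx
  then show ?thesis
    using I w unfolding attached_def ind6_def by (elim disjE) auto
qed

text \<open>The claw at \<open>a\<close> with leaf \<open>f\<close> makes these vertices pairwise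
  adjacent, and three of them give the 6-cycle \<open>b a x y z c\<close> with chord
  \<open>b x\<close>.\<close>

lemma ind6_triple_le_2:
  assumes H: "chorded_C6_free" and I: "ind6 a b c d e f"
  shows "card (attached {a, b, c, d, e, f} {a, b, c}) \<le> 2"
proof (rule card_le_2_if)
  let ?K = "attached {a, b, c, d, e, f} {a, b, c}"
  have adj: "E x y" if "x \<in> ?K" "y \<in> ?K" "x \<noteq> y" for x y
  proof -
    have "E a x" "E a y" "E a f" "\<not> E x f" "\<not> E y f" "x \<noteq> f" "y \<noteq> f"
      using that I E_commute by (auto simp: ind6_def attached_def)
    then show ?thesis using claw_free[of a f x y] that(3) E_commute by metis
  qed
  fix x y z assume xyz: "x \<in> ?K" "y \<in> ?K" "z \<in> ?K" "x \<noteq> y" "x \<noteq> z" "y \<noteq> z"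
  then have "E x y" "E y z" using adj by auto
  moreover have "E x a" "E z c" "E x b" "distinct [b, a, x, y, z, c]" "E a b" "E b c"
    using xyz I by (auto simp: ind6_def attached_def)
  ultimately show False using chorded_C6_freeD[OF H, of b a x y z c] E_commute by metis
qed

text \<open>The 6-cycle \<open>b y d c x a\<close> would have the long chord
  \<open>b c\<close>.\<close>

lemma ind6_adjacent_triples:
  assumes H: "chorded_C6_free" and I: "ind6 a b c d e f"
  shows "attached {a, b, c, d, e, f} {a, b, c} = {} \<or> attached {a, b, c, d, e, f} {b, c, d} = {}"
proof (rule ccontr)
  assume "\<not> ?thesis"
  then obtain x y where "x \<in> attached {a, b, c, d, e, f} {a, b, c}"
    "y \<in> attached {a, b, c, d, e, f} {b, c, d}"
    by blast
  then have e: "E x a" "E x b" "E x c" "E y b" "E y c" "\<not> E x d" "E y d"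
    and d: "distinct [b, y, d, c, x, a]"
    using I by (auto simp: ind6_def attached_def)
  then show False
    using chorded_C6_freeD[OF H d] I e E_commute unfolding ind6_def by metis
qed

lemma common_edge_le_1:
  assumes H: "diamond_free" and "E a b" "a \<in> A" "b \<in> A" "A \<subseteq> Z"
  shows "card (attached Z A) \<le> 1"
proof (rule card_le_1_if, rule ccontr)
  fix x y assume xy: "x \<in> attached Z A" "y \<in> attached Z A" "x \<noteq> y"
  then have "E x a" "E x b" "E y a" "E y b" "distinct [a, x, b, y]"
    using assms by (auto simp: attached_def)
  then show False using diamond_freeD[OF H, of a x b y] assms(2) E_commute by metis
qed

text \<open>A vertex \<open>u\<close> at distance two would begin the induced path
  \<open>u w b c d e\<close>.\<close>

lemma ind5_edge_no_distance_two:
  assumes I: "ind5 a b c d e" and w: "w \<in> attached {a, b, c, d, e} {a, b}" "E w u"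
    "u \<notin> {a, b, c, d, e}"
  shows "\<exists>z\<in>{a, b, c, d, e}. E u z"
proof (rule ccontr)
  assume n: "\<not> ?thesis"
  have e: "E w b" "\<not> E w c" "\<not> E w d" "\<not> E w e" and d: "distinct [u, w, b, c, d, e]"
    using w I E_neq[OF w(2)] by (auto simp: ind5_def attached_def)
  show False using P6_free[OF d] n e E_sym[OF w(2)] I unfolding ind5_def by auto
qed

end

section \<open>Bounding the order around an induced cycle\<close>

context two_connected_claw_P6_free
begin

text \<open>\<open>near\<close> rules out distance two from \<open>Z\<close>, so \<open>Z\<close> is
  dominating and \<open>cover\<close> sorts every outside vertex into one of the listed
  kinds.\<close>

lemma card_le_attached:
  assumes "Z \<subseteq> V" "Z \<noteq> {}"
    and cover: "\<And>w. w \<in> V \<Longrightarrow> w \<notin> Z \<Longrightarrow> \<exists>z\<in>Z. E w z \<Longrightarrow> \<exists>A\<in>set As. w \<in> attached Z A"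
    and near: "\<And>A w u. A \<in> set As \<Longrightarrow> w \<in> attached Z A \<Longrightarrow> E w u \<Longrightarrow> u \<notin> Z \<Longrightarrow> \<exists>z\<in>Z. E u z"
  shows "card V \<le> card Z + (\<Sum>A\<leftarrow>As. card (attached Z A))"
proof -
  let ?U = "\<Union> (attached Z ` set As)"
  have "V \<subseteq> Z \<union> ?U"
  proof
    fix v assume v: "v \<in> V"
    show "v \<in> Z \<union> ?U"
    proof (cases "v \<in> Z")
      case False
      have "\<exists>z\<in>Z. E v z"
      proof (rule dominating_if_no_distance_two[OF assms(1,2) _ v False])
        fix z w u assume "z \<in> Z" "w \<notin> Z" "E w z" "E w u" "u \<notin> Z"
        then show "\<exists>z\<in>Z. E u z" using cover[of w] near E_in_V by blast
      qed
      then show ?thesis using cover v False by blast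
    qed simp
  qed
  then have "card V \<le> card (Z \<union> ?U)"
    using assms(1) finite_V finite_attached by (intro card_mono) (auto intro: finite_subset)
  moreover have "card (\<Union> (attached Z ` set Bs)) \<le> (\<Sum>A\<leftarrow>Bs. card (attached Z A))" for Bs
  proof (induction Bs)
    case (Cons B Bs)
    then show ?case using card_Un_le[of "attached Z B" "\<Union> (attached Z ` set Bs)"] by simp
  qed simp
  ultimately show ?thesis using card_Un_le[of Z ?U] le_trans by (meson add_left_mono)
qed

lemma ind_in_V: "ind6 a b c d e f \<Longrightarrow> {a, b, c, d, e, f} \<subseteq> V" "ind5 a b c d e \<Longrightarrow> {a, b, c, d, e} \<subseteq> V"
  "ind4 a b c d \<Longrightarrow> {a, b, c, d} \<subseteq> V"
  using E_in_V by (auto simp: ind6_def ind5_def ind4_def)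

lemma house_free_ind6_bound:
  assumes H: "house_free" and I: "ind6 a b c d e f"
  shows "card V \<le> 12"
proof -
  let ?Z = "{a, b, c, d, e, f}" and ?As = "[{a, b, c}, {b, c, d}, {c, d, e}, {d, e, f},
    {e, f, a}, {f, a, b}]"
  let ?K = "attached ?Z"
  note I1 = ind6_rotate[OF I]
  note I2 = ind6_rotate[OF I1]
  note I3 = ind6_rotate[OF I2]
  note I4 = ind6_rotate[OF I3]
  note I5 = ind6_rotate[OF I4]
  have "card V \<le> card ?Z + (\<Sum>A\<leftarrow>?As. card (?K A))"
  proof (rule card_le_attached)
    show "?Z \<subseteq> V" using ind_in_V(1)[OF I] .
    show "\<exists>A\<in>set ?As. w \<in> ?K A" if "w \<in> V" "w \<notin> ?Z" "\<exists>z\<in>?Z. E w z" for w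
      using ind6_house_cover[OF H I that] .
    show "\<exists>z\<in>?Z. E u z" if "A \<in> set ?As" "w \<in> ?K A" "E w u" "u \<notin> ?Z" for A w u
      using attached_opposite_no_distance_two[of w ?Z "{a, b, c}" a c u]
        attached_opposite_no_distance_two[of w ?Z "{b, c, d}" b d u]
        attached_opposite_no_distance_two[of w ?Z "{c, d, e}" c e u]
        attached_opposite_no_distance_two[of w ?Z "{d, e, f}" d f u]
        attached_opposite_no_distance_two[of w ?Z "{e, f, a}" a e u]
        attached_opposite_no_distance_two[of w ?Z "{f, a, b}" b f u]
        that I unfolding ind6_def by (simp del: bex_simps) (elim disjE; simp)
  qed simp
  moreover have "card ?Z = 6" using I by (simp add: ind6_def)
  moreover have "card (?K {a, b, c}) \<le> 1"
    "card (?K {b, c, d}) \<le> 1"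
    "card (?K {c, d, e}) \<le> 1"
    "card (?K {d, e, f}) \<le> 1"
    "card (?K {e, f, a}) \<le> 1"
    "card (?K {f, a, b}) \<le> 1"
    using ind6_triple_le_1[OF H I]
      ind6_triple_le_1[OF H I1]
      ind6_triple_le_1[OF H I2]
      ind6_triple_le_1[OF H I3]
      ind6_triple_le_1[OF H I4]
      ind6_triple_le_1[OF H I5]
    by (simp_all add: insert_commute)
  ultimately show ?thesis by simp
qed

text \<open>The five edges exclude each other cyclically, so at most two of them carry vertices, two
  each; likewise at most two triples, one vertex each. The sum is 5 + 4 + 2 = 11.\<close>

lemma house_free_ind5_bound:
  assumes H: "house_free" and I: "ind5 a b c d e"
  shows "card V \<le> 12"
proof -
  let ?Z = "{a, b, c, d, e}" and ?As = "[{a, b}, {b, c}, {c, d}, {d, e}, {e, a}, {a, b, c},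
    {b, c, d}, {c, d, e}, {d, e, a}, {e, a, b}]"
  let ?K = "attached ?Z"
  note I1 = ind5_rotate[OF I]
  note I2 = ind5_rotate[OF I1]
  note I3 = ind5_rotate[OF I2]
  note I4 = ind5_rotate[OF I3]
  have "card V \<le> card ?Z + (\<Sum>A\<leftarrow>?As. card (?K A))"
  proof (rule card_le_attached)
    show "?Z \<subseteq> V" using ind_in_V(2)[OF I] .
    show "\<exists>A\<in>set ?As. w \<in> ?K A" if "w \<in> V" "w \<notin> ?Z" "\<exists>z\<in>?Z. E w z" for w
      using ind5_house_cover[OF H I that] .
    show "\<exists>z\<in>?Z. E u z" if "A \<in> set ?As" "w \<in> ?K A" "E w u" "u \<notin> ?Z" for A w u
      using ind5_edge_no_distance_two[OF I, of w u]
        ind5_edge_no_distance_two[OF I1, of w u]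
        ind5_edge_no_distance_two[OF I2, of w u]
        ind5_edge_no_distance_two[OF I3, of w u]
        ind5_edge_no_distance_two[OF I4, of w u]
        attached_opposite_no_distance_two[of w ?Z "{a, b, c}" a c u]
        attached_opposite_no_distance_two[of w ?Z "{b, c, d}" b d u]
        attached_opposite_no_distance_two[of w ?Z "{c, d, e}" c e u]
        attached_opposite_no_distance_two[of w ?Z "{d, e, a}" a d u]
        attached_opposite_no_distance_two[of w ?Z "{e, a, b}" b e u]
        that I unfolding ind5_def
          by (simp add: insert_commute del: bex_simps) (elim disjE; simp add: insert_commute)
  qed simp
  moreover have "card ?Z = 5" using I by (simp add: ind5_def)
  moreover have "card (?K {a, b}) \<le> 2"
    "card (?K {b, c}) \<le> 2"
    "card (?K {c, d}) \<le> 2"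
    "card (?K {d, e}) \<le> 2"
    "card (?K {e, a}) \<le> 2"
    using ind5_edge_le_2[OF H I]
      ind5_edge_le_2[OF H I1]
      ind5_edge_le_2[OF H I2]
      ind5_edge_le_2[OF H I3]
      ind5_edge_le_2[OF H I4]
    by (simp_all add: insert_commute)
  moreover have "card (?K {a, b, c}) \<le> 1"
    "card (?K {b, c, d}) \<le> 1"
    "card (?K {c, d, e}) \<le> 1"
    "card (?K {d, e, a}) \<le> 1"
    "card (?K {e, a, b}) \<le> 1"
    using ind5_triple_le_1[OF H I]
      ind5_triple_le_1[OF H I1]
      ind5_triple_le_1[OF H I2]
      ind5_triple_le_1[OF H I3]
      ind5_triple_le_1[OF H I4]
    by (simp_all add: insert_commute)
  moreover have "card (?K {a, b}) = 0 \<or> card (?K {b, c}) = 0"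
    "card (?K {b, c}) = 0 \<or> card (?K {c, d}) = 0"
    "card (?K {c, d}) = 0 \<or> card (?K {d, e}) = 0"
    "card (?K {d, e}) = 0 \<or> card (?K {e, a}) = 0"
    "card (?K {e, a}) = 0 \<or> card (?K {a, b}) = 0"
    using ind5_adjacent_edges[OF H I]
      ind5_adjacent_edges[OF H I1]
      ind5_adjacent_edges[OF H I2]
      ind5_adjacent_edges[OF H I3]
      ind5_adjacent_edges[OF H I4]
    by (auto simp: insert_commute)
  moreover have "card (?K {a, b, c}) = 0 \<or> card (?K {b, c, d}) = 0"
    "card (?K {b, c, d}) = 0 \<or> card (?K {c, d, e}) = 0"
    "card (?K {c, d, e}) = 0 \<or> card (?K {d, e, a}) = 0"
    "card (?K {d, e, a}) = 0 \<or> card (?K {e, a, b}) = 0"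
    "card (?K {e, a, b}) = 0 \<or> card (?K {a, b, c}) = 0"
    using ind5_adjacent_triples[OF H I]
      ind5_adjacent_triples[OF H I1]
      ind5_adjacent_triples[OF H I2]
      ind5_adjacent_triples[OF H I3]
      ind5_adjacent_triples[OF H I4]
    by (auto simp: insert_commute)
  ultimately show ?thesis by (simp only: list.map sum_list.Cons sum_list.Nil) linarith
qed

lemma diamond_free_ind5_bound:
  assumes H: "diamond_free" and I: "ind5 a b c d e"
  shows "card V \<le> 10"
proof -
  let ?Z = "{a, b, c, d, e}" and ?As = "[{a, b}, {b, c}, {c, d}, {d, e}, {e, a}]"
  let ?K = "attached ?Z"
  note I1 = ind5_rotate[OF I]
  note I2 = ind5_rotate[OF I1]
  note I3 = ind5_rotate[OF I2]
  note I4 = ind5_rotate[OF I3]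
  have "card V \<le> card ?Z + (\<Sum>A\<leftarrow>?As. card (?K A))"
  proof (rule card_le_attached)
    show "?Z \<subseteq> V" using ind_in_V(2)[OF I] .
    show "\<exists>A\<in>set ?As. w \<in> ?K A" if "w \<in> V" "w \<notin> ?Z" "\<exists>z\<in>?Z. E w z" for w
      using ind5_diamond_cover[OF H I that] .
    show "\<exists>z\<in>?Z. E u z" if "A \<in> set ?As" "w \<in> ?K A" "E w u" "u \<notin> ?Z" for A w u
      using ind5_edge_no_distance_two[OF I, of w u]
        ind5_edge_no_distance_two[OF I1, of w u]
        ind5_edge_no_distance_two[OF I2, of w u]
        ind5_edge_no_distance_two[OF I3, of w u]
        ind5_edge_no_distance_two[OF I4, of w u]
        that by (simp add: insert_commute del: bex_simps) (elim disjE; simp add: insert_commute)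
  qed simp
  moreover have "card ?Z = 5" using I by (simp add: ind5_def)
  moreover have "card (?K {a, b}) \<le> 1"
    "card (?K {b, c}) \<le> 1"
    "card (?K {c, d}) \<le> 1"
    "card (?K {d, e}) \<le> 1"
    "card (?K {e, a}) \<le> 1"
    using common_edge_le_1[OF H, of a b "{a, b}" ?Z]
      common_edge_le_1[OF H, of b c "{b, c}" ?Z]
      common_edge_le_1[OF H, of c d "{c, d}" ?Z]
      common_edge_le_1[OF H, of d e "{d, e}" ?Z]
      common_edge_le_1[OF H, of e a "{e, a}" ?Z]
    I unfolding ind5_def by simp_all
  ultimately show ?thesis by simp
qed

lemma diamond_free_ind6_bound:
  assumes H: "diamond_free" and I: "ind6 a b c d e f"
  shows "card V \<le> 9"
proof -
  let ?Z = "{a, b, c, d, e, f}" and ?As = "[{a, b, d, e}, {b, c, e, f}, {c, d, f, a}]"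
  let ?K = "attached ?Z"
  have "card V \<le> card ?Z + (\<Sum>A\<leftarrow>?As. card (?K A))"
  proof (rule card_le_attached)
    show "?Z \<subseteq> V" using ind_in_V(1)[OF I] .
    show "\<exists>A\<in>set ?As. w \<in> ?K A" if "w \<in> V" "w \<notin> ?Z" "\<exists>z\<in>?Z. E w z" for w
      using ind6_diamond_cover[OF H I that] .
    show "\<exists>z\<in>?Z. E u z" if "A \<in> set ?As" "w \<in> ?K A" "E w u" "u \<notin> ?Z" for A w u
      using attached_opposite_no_distance_two[of w ?Z "{a, b, d, e}" a d u]
        attached_opposite_no_distance_two[of w ?Z "{b, c, e, f}" b e u]
        attached_opposite_no_distance_two[of w ?Z "{c, d, f, a}" c f u]
        that I unfolding ind6_def by (simp del: bex_simps) (elim disjE; simp)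
  qed simp
  moreover have "card ?Z = 6" using I by (simp add: ind6_def)
  moreover have "card (?K {a, b, d, e}) \<le> 1"
    "card (?K {b, c, e, f}) \<le> 1"
    "card (?K {c, d, f, a}) \<le> 1"
    using common_edge_le_1[OF H, of a b "{a, b, d, e}" ?Z]
      common_edge_le_1[OF H, of b c "{b, c, e, f}" ?Z]
      common_edge_le_1[OF H, of c d "{c, d, f, a}" ?Z]
    I unfolding ind6_def by simp_all
  ultimately show ?thesis by simp
qed

text \<open>Two vertices for each of six triples would be too many. Grouping neighbouring triples
  into three pairs, of which only one member is nonempty, leaves 6 + 3 * 2.\<close>

lemma chorded_C6_free_ind6_bound:
  assumes H: "chorded_C6_free" and I: "ind6 a b c d e f"
  shows "card V \<le> 12"
proof -
  let ?Z = "{a, b, c, d, e, f}" and ?As = "[{a, b, c}, {b, c, d}, {c, d, e}, {d, e, f},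
    {e, f, a}, {f, a, b}]"
  let ?K = "attached ?Z"
  note I1 = ind6_rotate[OF I]
  note I2 = ind6_rotate[OF I1]
  note I3 = ind6_rotate[OF I2]
  note I4 = ind6_rotate[OF I3]
  note I5 = ind6_rotate[OF I4]
  have "card V \<le> card ?Z + (\<Sum>A\<leftarrow>?As. card (?K A))"
  proof (rule card_le_attached)
    show "?Z \<subseteq> V" using ind_in_V(1)[OF I] .
    show "\<exists>A\<in>set ?As. w \<in> ?K A" if "w \<in> V" "w \<notin> ?Z" "\<exists>z\<in>?Z. E w z" for w
      using ind6_chorded_C6_cover[OF H I that] .
    show "\<exists>z\<in>?Z. E u z" if "A \<in> set ?As" "w \<in> ?K A" "E w u" "u \<notin> ?Z" for A w u
      using attached_opposite_no_distance_two[of w ?Z "{a, b, c}" a c u]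
        attached_opposite_no_distance_two[of w ?Z "{b, c, d}" b d u]
        attached_opposite_no_distance_two[of w ?Z "{c, d, e}" c e u]
        attached_opposite_no_distance_two[of w ?Z "{d, e, f}" d f u]
        attached_opposite_no_distance_two[of w ?Z "{e, f, a}" a e u]
        attached_opposite_no_distance_two[of w ?Z "{f, a, b}" b f u]
        that I unfolding ind6_def by (simp del: bex_simps) (elim disjE; simp)
  qed simp
  moreover have "card ?Z = 6" using I by (simp add: ind6_def)
  moreover have "card (?K {a, b, c}) \<le> 2"
    "card (?K {b, c, d}) \<le> 2"
    "card (?K {c, d, e}) \<le> 2"
    "card (?K {d, e, f}) \<le> 2"
    "card (?K {e, f, a}) \<le> 2"
    "card (?K {f, a, b}) \<le> 2"
    using ind6_triple_le_2[OF H I]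
      ind6_triple_le_2[OF H I1]
      ind6_triple_le_2[OF H I2]
      ind6_triple_le_2[OF H I3]
      ind6_triple_le_2[OF H I4]
      ind6_triple_le_2[OF H I5]
    by (simp_all add: insert_commute)
  moreover have "card (?K {a, b, c}) = 0 \<or> card (?K {b, c, d}) = 0"
    "card (?K {c, d, e}) = 0 \<or> card (?K {d, e, f}) = 0"
    "card (?K {e, f, a}) = 0 \<or> card (?K {f, a, b}) = 0"
    using ind6_adjacent_triples[OF H I]
      ind6_adjacent_triples[OF H I2]
      ind6_adjacent_triples[OF H I4]
    by (auto simp: insert_commute)
  ultimately show ?thesis by (simp only: list.map sum_list.Cons sum_list.Nil) linarith
qed

section \<open>Short chorded cycles\<close>

lemma house_exists:
  assumes n: "13 \<le> card V"
  shows "\<not> house_free"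
proof
  assume H: "house_free"
  define P where "P = (\<lambda>C. cyc C \<and> 5 \<le> length C)"
  obtain C0 where "P C0" using cycle_ge5_exists n P_def by auto
  then obtain C where "P C" and min': "\<forall>C'. P C' \<longrightarrow> length C \<le> length C'"
    using ex_has_least_nat[of P C0 length] by blast
  then have C: "cyc C" "5 \<le> length C" and min: "\<And>C'. cyc C' \<Longrightarrow> 5 \<le> length C' \<Longrightarrow> length C \<le> length C'"
    by (auto simp: P_def)
  consider (5) "length C = 5" | (6) "length C = 6" | (7) "7 \<le> length C" using C(2) by linarith
  then show False
  proof cases
    case 5
    then obtain a b c d e where abc: "C = [a, b, c, d, e]"
      by (auto simp: length_Suc_conv numeral_eq_Suc)
    have *: "distinct [a, b, c, d, e]" "E a b" "E b c" "E c d" "E d e" "E e a"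
      using C(1) abc by (auto simp: cyc_def)
    have "\<not> E a c" "\<not> E a d" "\<not> E b d" "\<not> E b e" "\<not> E c e"
      using house_freeD[OF H, of a b c d e] house_freeD[OF H, of b c d e a]
        house_freeD[OF H, of c d e a b] house_freeD[OF H, of d e a b c]
        house_freeD[OF H, of e a b c d] * E_commute by auto
    then have "ind5 a b c d e" using * by (simp add: ind5_def)
    then show False using house_free_ind5_bound[OF H] n by fastforce
  next
    case 6
    then obtain a b c d e f where abc: "C = [a, b, c, d, e, f]"
      by (auto simp: length_Suc_conv numeral_eq_Suc)
    have *: "distinct [a, b, c, d, e, f]" "E a b" "E b c" "E c d" "E d e" "E e f" "E f a"
      using C(1) abc by (auto simp: cyc_def)
    have no5: "\<not> cyc [p, q, r, s, t]" for p q r s t using min[of "[p, q, r, s, t]"] 6 by auto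
    have short: "\<not> E a c" "\<not> E b d" "\<not> E c e" "\<not> E d f" "\<not> E a e" "\<not> E b f"
      using no5[of a c d e f] no5[of b d e f a] no5[of c e f a b] no5[of d f a b c]
        no5[of e a b c d] no5[of f b c d e] * E_commute by (auto simp: cyc_def)
    \<comment> \<open>Short chords would shorten the cycle to length 5. A long chord is then the
      third edge of a claw at its end.\<close>
    have "\<not> E a d" "\<not> E b e" "\<not> E c f"
      using claw_free[of a b f d] claw_free[of b c a e] claw_free[of c d b f] short * E_commute
      by auto
    then have "ind6 a b c d e f" using * short by (simp add: ind6_def)
    then show False using house_free_ind6_bound[OF H] n by fastforce
  next
    case 7
    then obtain a b c d e f g R where abc: "C = a # b # c # d # e # f # g # R"
      by (auto simp: Suc_le_length_iff numeral_eq_Suc)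
    have *: "distinct [a, b, c, d, e, f]" "E a b" "E b c" "E c d" "E d e" "E e f" "E f g"
      using C(1) abc by (auto simp: cyc_def)
    consider "E a c" | "E b d" | "E c e" | "E d f" | "E a d" | "E b e" | "E c f" | "E a e" | "E b
      f" | "E a f"
      using P6_free[OF *(1-6)] by blast
    \<comment> \<open>A chord that skips one or two vertices leaves at least five of the seven or
      more; the chords \<open>a e\<close>, \<open>b f\<close> and \<open>a f\<close> close the short
      side to a cycle of length 5 or 6.\<close>
    then have "\<exists>C'. cyc C' \<and> 5 \<le> length C' \<and> length C' < length C"
    proof cases
      case 1 then show ?thesis
        using C(1) abc by (intro exI[of _ "a # c # d # e # f # g # R"]) (auto simp: cyc_def)
    next
      case 2 then show ?thesis
        using C(1) abc by (intro exI[of _ "a # b # d # e # f # g # R"]) (auto simp: cyc_def)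
    next
      case 3 then show ?thesis
        using C(1) abc by (intro exI[of _ "a # b # c # e # f # g # R"]) (auto simp: cyc_def)
    next
      case 4 then show ?thesis
        using C(1) abc by (intro exI[of _ "a # b # c # d # f # g # R"]) (auto simp: cyc_def)
    next
      case 5 then show ?thesis
        using C(1) abc by (intro exI[of _ "a # d # e # f # g # R"]) (auto simp: cyc_def)
    next
      case 6 then show ?thesis
        using C(1) abc by (intro exI[of _ "a # b # e # f # g # R"]) (auto simp: cyc_def)
    next
      case 7 then show ?thesis
        using C(1) abc by (intro exI[of _ "a # b # c # f # g # R"]) (auto simp: cyc_def)
    next
      case 8 then show ?thesis
        using C(1) abc E_sym by (intro exI[of _ "[a, b, c, d, e]"]) (auto simp: cyc_def)
    next
      case 9 then show ?thesis
        using C(1) abc E_sym by (intro exI[of _ "[b, c, d, e, f]"]) (auto simp: cyc_def)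
    next
      case 10 then show ?thesis
        using C(1) abc E_sym by (intro exI[of _ "[a, b, c, d, e, f]"]) (auto simp: cyc_def)
    qed
    then show False using min by fastforce
  qed
qed

lemma cycles_of_all_lengths:
  assumes "13 \<le> card V" "5 \<le> m" "m \<le> card V"
  shows "\<exists>C. cyc C \<and> length C = m"
  using assms(2,3)
proof (induction m rule: dec_induct)
  case base
  obtain a b c d e where "distinct [a, b, c, d, e]" "E a b" "E b c" "E c d" "E d e" "E e a"
    using house_exists[OF assms(1)] unfolding house_free_def by blast
  then show ?case by (intro exI[of _ "[a, b, c, d, e]"]) (simp add: cyc_def)
next
  case (step m)
  then obtain C where C: "cyc C" "length C = m" by auto
  have "set C \<noteq> V" using C step by (metis cyc_def distinct_card Suc_n_not_le_n)
  then show ?case using longer_cycle[OF C(1)] C step by auto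
qed

lemma chorded_C6_exists:
  assumes n: "13 \<le> card V"
  shows "\<not> chorded_C6_free"
proof
  assume H: "chorded_C6_free"
  obtain C where C: "cyc C" "length C = 6" using cycles_of_all_lengths[OF n, of 6] n by auto
  then obtain a b c d e f where abc: "C = [a, b, c, d, e, f]"
    by (auto simp: length_Suc_conv numeral_eq_Suc)
  have *: "distinct [a, b, c, d, e, f]" "E a b" "E b c" "E c d" "E d e" "E e f" "E f a"
    using C(1) abc by (auto simp: cyc_def)
  have "\<not> E a c" "\<not> E a d" "\<not> E b d" "\<not> E b e" "\<not> E c e" "\<not> E c f" "\<not> E d f" "\<not> E a e" "\<not> E b f"
    using chorded_C6_freeD[OF H, of a b c d e f] chorded_C6_freeD[OF H, of b c d e f a]
      chorded_C6_freeD[OF H, of c d e f a b] chorded_C6_freeD[OF H, of d e f a b c]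
      chorded_C6_freeD[OF H, of e f a b c d] chorded_C6_freeD[OF H, of f a b c d e] * E_commute
    by auto
  then have "ind6 a b c d e f" using * by (simp add: ind6_def)
  then show False using chorded_C6_free_ind6_bound[OF H] n by fastforce
qed

section \<open>Induced 4-cycles and vertices at distance two\<close>

lemma ind4_far_step:
  assumes I: "ind4 a b c d" and w: "w \<in> attached {a, b, c, d} {a, b}"
    and x: "x \<notin> {a, b, c, d}" "\<not> (\<exists>z\<in>{a, b, c, d}. E x z)"
    and y: "y \<notin> {a, b, c, d}" "\<not> (\<exists>z\<in>{a, b, c, d}. E y z)"
    and "E x w" "E x y"
  shows "E y w"
proof (rule ccontr)
  assume n: "\<not> E y w"
  have wz: "E w b" "\<not> E w c" "\<not> E w d" "w \<notin> {a, b, c, d}"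
    using w I by (auto simp: attached_def ind4_def)
  have xy: "\<not> E x b" "\<not> E x c" "\<not> E x d" "\<not> E y b" "\<not> E y c" "\<not> E y d" using x y by auto
  have "y \<noteq> w" using y(2) wz(1) by auto
  then have d: "distinct [y, x, w, b, c, d]"
    using x y wz I E_neq[OF assms(7)] E_neq[OF assms(8)] by (auto simp: ind4_def)
  show False
    \<comment> \<open>The path \<open>y x w b c d\<close> would be induced. Hence, among the
      vertices with no neighbour on the 4-cycle, those adjacent to \<open>w\<close> are closed under
      adjacency.\<close>
    using P6_free[OF d] xy wz I n assms(7,8) E_commute unfolding ind4_def by metis
qed

text \<open>
  Vertices at distance two from an induced 4-cycle hang on adjacent vertices attached to opposite
  edges: a neighbour set containing only one attached vertex would make that vertex a cut vertex,
  and the other positions produce induced cycles of length 5 or 6.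
\<close>

lemma ind4_distance_two:
  assumes H: "diamond_free" and I: "ind4 a b c d"
    and no5: "\<And>p q r s t. \<not> ind5 p q r s t" and no6: "\<And>p q r s t x. \<not> ind6 p q r s t x"
    and w: "w \<in> attached {a, b, c, d} {a, b}"
    and u: "E u w" "u \<notin> {a, b, c, d}" "\<not> (\<exists>z\<in>{a, b, c, d}. E u z)"
  shows "\<exists>w'\<in>attached {a, b, c, d} {c, d}. E w w' \<and> E u w'"
proof -
  let ?Z = "{a, b, c, d}"
  let ?K = "attached ?Z"
  define U where "U = {x \<in> V. x \<notin> ?Z \<and> \<not> (\<exists>z\<in>?Z. E x z)}"
  define S where "S = {x \<in> U. E x w}"
  have wz: "E w a" "E w b" "\<not> E w c" "\<not> E w d" "w \<notin> ?Z" "w \<in> V"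
    using w I by (auto simp: attached_def ind4_def)
  have U: "x \<noteq> a" "x \<noteq> b" "x \<noteq> c" "x \<noteq> d" "\<not> E x a" "\<not> E x b" "\<not> E x c" "\<not> E x d" "x \<noteq> w"
    if "x \<in> U" for x using that wz by (auto simp: U_def)
  have closed: "E y w" if "x \<in> U" "y \<in> U" "E x w" "E x y" for x y
    using ind4_far_step[OF I w _ _ _ _ that(3,4)] that(1,2) by (simp add: U_def)
  have uU: "u \<in> U" using u E_in_V by (auto simp: U_def)
  have "S \<subseteq> V - {w}" by (auto simp: S_def U_def)
  moreover have "u \<in> S" using uU u by (simp add: S_def)
  moreover have "a \<in> V - {w}" "a \<notin> S" using wz ind_in_V(3)[OF I] by (auto simp: S_def U_def)
  \<comment> \<open>With \<open>w\<close> deleted an edge still leaves \<open>S\<close>. By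
    \<open>closed\<close> it cannot end in \<open>U\<close>, so \<open>w'\<close> is a second
    attached vertex.\<close>
  ultimately obtain x w' where x: "x \<in> S" and w': "w' \<in> V" "w' \<noteq> w" "w' \<notin> S" "E x w'"
    using two_connected[of "{w}" S] wz(6) by fastforce
  have xU: "x \<in> U" "E x w" using x by (auto simp: S_def)
  have "w' \<notin> U" using closed[of x w'] xU w' by (auto simp: S_def)
  moreover have w'Z: "w' \<notin> ?Z" using U[OF xU(1)] w'(4) by auto
  ultimately have "\<exists>z\<in>?Z. E w' z" using w' by (auto simp: U_def)
  then have "w' \<in> ?K {a, b} \<or> w' \<in> ?K {b, c} \<or> w' \<in> ?K {c, d} \<or> w' \<in> ?K {d, a}"
    using ind4_diamond_cover[OF H I w'(1) w'Z] by simp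
  moreover have "w' \<notin> ?K {a, b}"
  proof
    assume "w' \<in> ?K {a, b}"
    then have "E w' a" "E w' b" by (auto simp: attached_def)
    then show False
      using diamond_freeD[OF H, of a w b w'] wz I w'(2) w'Z E_commute by (auto simp: ind4_def)
  qed
  moreover have "w' \<notin> ?K {b, c}"
  proof
    assume "w' \<in> ?K {b, c}"
    then have e: "E w' b" "E w' c" "\<not> E w' a" "\<not> E w' d" using I by (auto simp: attached_def ind4_def)
    have "\<not> E w w'"
      using diamond_freeD[OF H, of w w' b a] e wz I w'(2) w'Z E_commute by (auto simp: ind4_def)
    then have "ind6 x w a d c w'"
      using e wz I w' w'Z xU U[OF xU(1)] E_commute by (auto simp: ind4_def ind6_def)
    then show False using no6 by blast
  qed
  moreover have "w' \<notin> ?K {d, a}"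
  proof
    assume "w' \<in> ?K {d, a}"
    then have e: "E w' a" "E w' d" "\<not> E w' b" "\<not> E w' c" using I by (auto simp: attached_def ind4_def)
    have "\<not> E w w'"
      using diamond_freeD[OF H, of w w' a b] e wz I w'(2) w'Z E_commute by (auto simp: ind4_def)
    then have "ind6 x w b c d w'"
      using e wz I w' w'Z xU U[OF xU(1)] E_commute by (auto simp: ind4_def ind6_def)
    then show False using no6 by blast
  qed
  ultimately have K: "w' \<in> ?K {c, d}" by blast
  then have e: "E w' c" "E w' d" "\<not> E w' a" "\<not> E w' b" using I by (auto simp: attached_def ind4_def)
  have ww': "E w w'"
  proof (rule ccontr)
    assume "\<not> E w w'"
    then have "ind5 x w b c w'"
      using e wz I w' w'Z xU U[OF xU(1)] E_commute by (auto simp: ind4_def ind5_def)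
    then show False using no5 by blast
  qed
  have "E u w'"
  proof (cases "u = x")
    case False
    \<comment> \<open>The vertex \<open>x\<close> at which \<open>S\<close> is left need not be
      \<open>u\<close>. The claw at \<open>w\<close> with leaf \<open>a\<close> joins the two, and
      the step at \<open>w'\<close> on the rotated cycle carries the adjacency from \<open>x\<close>
      to \<open>u\<close>.\<close>
    have ux: "E u x"
      using claw_free[of w a u x] wz xU u(1) uU U[OF xU(1)] U[OF uU] False E_commute by metis
    have "ind4 c d a b" "{c, d, a, b} = ?Z" using ind4_rotate ind4_rotate I by auto
    then show ?thesis
      using ind4_far_step[of c d a b w' x u] K xU(1) uU w'(4) ux
      by (simp add: U_def E_commute)
  qed (use w' in simp)
  then show ?thesis using K ww' by blast
qed

text \<open>The chord of a chorded 5-cycle cuts off a 4-cycle, which is induced when no 4-cycle has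
  a chord. The count is 4 for the cycle, one for each of its four edges, and one at distance two for
  each of the two pairs of opposite edges, hence 10.\<close>

lemma diamond_exists:
  assumes n: "13 \<le> card V"
  shows "\<not> diamond_free"
proof
  assume H: "diamond_free"
  have no5: "\<And>p q r s t. \<not> ind5 p q r s t" using diamond_free_ind5_bound[OF H] n by fastforce
  have no6: "\<And>p q r s t x. \<not> ind6 p q r s t x" using diamond_free_ind6_bound[OF H] n by fastforce
  obtain a x b c d where h: "distinct [a, x, b, c, d]" "E a x" "E x b" "E b c" "E c d" "E d a" "E a b"
    using house_exists[OF n] unfolding house_free_def by blast
  have I: "ind4 a b c d"
    using h diamond_freeD[OF H, of a b c d] diamond_freeD[OF H, of b c d a] by (auto simp: ind4_def)
  let ?Z = "{a, b, c, d}"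
  let ?K = "attached ?Z"
  define U where "U = {u \<in> V. u \<notin> ?Z \<and> \<not> (\<exists>z\<in>?Z. E u z)}"
  define D where "D A B = {u \<in> U. \<exists>w\<in>?K A. \<exists>w'\<in>?K B. E w w' \<and> E u w \<and> E u w'}" for A B
  have K1: "card (?K {a, b}) \<le> 1" "card (?K {b, c}) \<le> 1" "card (?K {c, d}) \<le> 1" "card (?K {d, a}) \<le> 1"
    using common_edge_le_1[OF H, of a b "{a, b}" ?Z] common_edge_le_1[OF H, of b c "{b, c}" ?Z]
      common_edge_le_1[OF H, of c d "{c, d}" ?Z] common_edge_le_1[OF H, of d a "{d, a}" ?Z] I
    by (auto simp: ind4_def)
  have far: "u \<in> D {a, b} {c, d} \<or> u \<in> D {b, c} {d, a}"
    if "u \<in> U" "E u w" "w \<in> V" "w \<notin> ?Z" "\<exists>z\<in>?Z. E w z" for u w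
  proof -
    have uZ: "u \<notin> ?Z" "\<not> (\<exists>z\<in>?Z. E u z)" using that(1) by (auto simp: U_def)
    note I1 = ind4_rotate[OF I]
    note I2 = ind4_rotate[OF I1]
    note I3 = ind4_rotate[OF I2]
    have r: "{b, c, d, a} = ?Z" "{c, d, a, b} = ?Z" "{d, a, b, c} = ?Z" by auto
    have "w \<in> ?K {a, b} \<or> w \<in> ?K {b, c} \<or> w \<in> ?K {c, d} \<or> w \<in> ?K {d, a}"
      using ind4_diamond_cover[OF H I that(3-5)] by simp
    then show ?thesis
    proof (elim disjE)
      assume "w \<in> ?K {a, b}"
      with ind4_distance_two[OF H I no5 no6 this that(2) uZ] that(1,2)
      show ?thesis unfolding D_def by blast
    next
      assume w: "w \<in> ?K {b, c}"
      with ind4_distance_two[OF H I1 no5 no6, unfolded r, OF w that(2) uZ] that(1,2)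
      show ?thesis unfolding D_def by blast
    next
      assume w: "w \<in> ?K {c, d}"
      with ind4_distance_two[OF H I2 no5 no6, unfolded r, OF w that(2) uZ] that(1,2) E_sym
      show ?thesis unfolding D_def by blast
    next
      assume w: "w \<in> ?K {d, a}"
      with ind4_distance_two[OF H I3 no5 no6, unfolded r, OF w that(2) uZ] that(1,2) E_sym
      show ?thesis unfolding D_def by blast
    qed
  qed
  \<comment> \<open>Each attached set has at most one element, so two vertices of
    \<open>D A B\<close> share \<open>w\<close> and \<open>w'\<close>, and \<open>w u w' v\<close>
    is a 4-cycle with chord \<open>w w'\<close>.\<close>
  have D1: "card (D A B) \<le> 1" if "card (?K A) \<le> 1" "card (?K B) \<le> 1" for A B
  proof (rule card_le_1_if, rule ccontr)
    fix u v assume uv: "u \<in> D A B" "v \<in> D A B" "u \<noteq> v"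
    have eq: "p = q" if "p \<in> ?K X" "q \<in> ?K X" "card (?K X) \<le> 1" for p q X
      using that finite_attached by (metis One_nat_def card_le_Suc0_iff_eq)
    obtain w w' where "w \<in> ?K A" "w' \<in> ?K B" "E w w'" "E u w"
      "E u w'" using uv(1) by (auto simp: D_def)
    moreover obtain y y' where "y \<in> ?K A" "y' \<in> ?K B" "E v y"
      "E v y'" using uv(2) by (auto simp: D_def)
    ultimately have e: "E w w'" "E u w" "E u w'" "E v w" "E v w'" using eq that by metis+
    then have "distinct [w, u, w', v]" using uv(3) by auto
    then show False using diamond_freeD[OF H, of w u w' v] e E_commute by metis
  qed
  let ?N = "?K {a, b} \<union> ?K {b, c} \<union> (?K {c, d} \<union> ?K {d, a})"
  let ?D = "D {a, b} {c, d} \<union> D {b, c} {d, a}"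
  have ZV: "?Z \<subseteq> V" using ind_in_V(3)[OF I] .
  have N: "w \<in> ?N" if "w \<in> V" "w \<notin> ?Z" "\<exists>z\<in>?Z. E w z" for w
    using ind4_diamond_cover[OF H I that] by auto
  have "V \<subseteq> ?Z \<union> ?N \<union> ?D"
  proof
    fix v assume v: "v \<in> V"
    show "v \<in> ?Z \<union> ?N \<union> ?D"
    proof (rule ccontr)
      assume n: "v \<notin> ?Z \<union> ?N \<union> ?D"
      then have nv: "v \<notin> ?Z \<union> ?N" by blast
      \<comment> \<open>Distance three from the 4-cycle is excluded by taking the cycle and its
        neighbours as dominating set: a far neighbour \<open>u\<close> of \<open>w\<close> inherits
        an attached neighbour \<open>y\<close> of \<open>w\<close> by
        \<open>ind4_far_step\<close>.\<close>
      have "\<exists>z\<in>?Z \<union> ?N. E v z"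
      proof (rule dominating_if_no_distance_two[OF _ _ _ v nv])
        show "?Z \<union> ?N \<subseteq> V" using ZV by (auto simp: attached_def)
        fix z w u assume *: "z \<in> ?Z \<union> ?N" "w \<notin> ?Z \<union> ?N" "E w z" "E w u" "u \<notin> ?Z \<union> ?N"
        have "w \<in> V" "u \<in> V" using * E_in_V E_sym by blast+
        then have wu: "w \<in> U" "u \<in> U" using N[of w] N[of u] *(2,5) unfolding U_def by blast+
        then have "z \<in> ?N" using * E_sym unfolding U_def by blast
        then have zV: "z \<in> V" "z \<notin> ?Z" "\<exists>y\<in>?Z. E z y" by (auto simp: attached_def)
        from far[OF wu(1) *(3) zV] obtain A B y where y: "y \<in> ?K A" "E w y" "A \<in> {{a, b}, {b, c}}"
          unfolding D_def by blast
        have wZ: "w \<notin> ?Z" "\<not> (\<exists>z\<in>?Z. E w z)" and uZ: "u \<notin> ?Z" "\<not> (\<exists>z\<in>?Z. E u z)"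
          using wu by (auto simp: U_def)
        have "{b, c, d, a} = ?Z" by auto
        then have "E u y"
          using y ind4_far_step[OF I _ wZ uZ y(2) *(4)] ind4_far_step[OF ind4_rotate[OF I] _ _ _ _
            _ y(2) *(4)] wZ uZ
          by auto
        then show "\<exists>z\<in>?Z \<union> ?N. E u z" using y by blast
      qed simp
      then obtain z where z: "z \<in> ?Z \<union> ?N" "E v z" by blast
      have vU: "v \<in> U" using N[of v] nv v unfolding U_def by blast
      then have "z \<in> ?N" using z E_sym unfolding U_def by blast
      then have zV: "z \<in> V" "z \<notin> ?Z" "\<exists>y\<in>?Z. E z y" by (auto simp: attached_def)
      show False using far[OF vU z(2) zV] n by blast
    qed
  qed
  then have "card V \<le> card (?Z \<union> ?N \<union> ?D)"
    using finite_V by (intro card_mono) (auto simp: finite_attached D_def U_def)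
  also have "\<dots> \<le> card ?Z + card ?N + card ?D" by (meson card_Un_le le_trans add_mono le_refl)
  also have "card ?N \<le> 4"
    using K1 card_Un_le[of "?K {a, b} \<union> ?K {b, c}" "?K {c, d} \<union> ?K {d, a}"]
      card_Un_le[of "?K {a, b}" "?K {b, c}"] card_Un_le[of "?K {c, d}" "?K {d, a}"] by linarith
  also have "card ?D \<le> 2"
    using D1[OF K1(1,3)] D1[OF K1(2,4)] card_Un_le[of "D {a, b} {c, d}" "D {b, c} {d, a}"] by linarith
  also have "card ?Z \<le> 4" by (simp add: card_insert_if)
  finally show False using n by simp
qed

end

section \<open>Transfer to digraphs\<close>

lemma chorded_cycleI:
  assumes G: "pair_graph G" and xs: "distinct xs" "3 \<le> length xs"
    and succ: "successively (\<lambda>u v. (u, v) \<in> parcs G) xs" "(last xs, hd xs) \<in> parcs G"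
    and chord: "u \<in> set xs" "v \<in> set xs" "(u, v) \<in> parcs G"
      "(u, v) \<notin> set (zip xs (tl xs @ [hd xs]))" "(v, u) \<notin> set (zip xs (tl xs @ [hd xs]))"
  shows "\<exists>p. chorded_cycle G p \<and> length p = length xs"
proof -
  interpret pair_graph G by (rule G)
  \<comment> \<open>The end \<open>z\<close> is kept separate from the start \<open>x\<close> so
    that induction can move the start along; \<open>z = x\<close> closes the walk.\<close>
  have walk: "pcas x (zip (x # ys) (ys @ [z])) z \<and>
    pawalk_verts x (zip (x # ys) (ys @ [z])) = x # ys @ [z]"
    for x z ys
    by (induction ys arbitrary: x) auto
  have arcs: "set (zip (x # ys) (ys @ [z])) \<subseteq> parcs G"
    if "successively (\<lambda>u v. (u, v) \<in> parcs G) (x # ys @ [z])" for x z ys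
    using that by (induction ys arbitrary: x) auto
  obtain x ys where xys: "xs = x # ys" using xs(2) by (cases xs) auto
  define p where "p = zip xs (tl xs @ [hd xs])"
  have p: "p = zip (x # ys) (ys @ [x])" by (simp add: p_def xys)
  have len: "length p = length xs" using xs(2) xys by (simp add: p)
  have "successively (\<lambda>u v. (u, v) \<in> parcs G) (xs @ [hd xs])"
    using succ xs(2) by (simp add: successively_append_iff)
  then have "successively (\<lambda>u v. (u, v) \<in> parcs G) (x # ys @ [x])"
    by (simp add: xys)
  then have sub: "set p \<subseteq> parcs G" using arcs p by simp
  moreover have "x \<in> pverts G" using succ(2) xys in_arcsD2 by auto
  ultimately have "awalk x p x" using walk[of x ys x] by (simp add: awalk_def p)
  moreover have "distinct (tl (pawalk_verts x p))" using walk[of x ys x] xs(1) xys by (simp add: p)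
  moreover have "p \<noteq> []" using len xys by auto
  ultimately have "cycle p" unfolding cycle_def by auto
  moreover have "fst ` set p = set xs"
  proof -
    have "map fst p = xs" by (simp add: p xys)
    then show ?thesis by (metis list.set_map)
  qed
  ultimately have "chorded_cycle G p"
    unfolding chorded_cycle_def using chord xs(2) len by (auto simp: p_def)
  then show ?thesis using len by blast
qed

text \<open>The isomorphism has to go from the induced subgraph to \<open>F\<close>, so the
  embedding \<open>f\<close> is inverted on its image and applied to both ends of each arc.\<close>

lemma induced_copy_not_free:
  assumes "pair_graph G" "F \<in> \<F>" "induced_free \<F> G" and f: "inj_on f (pverts F)"
    "f ` pverts F \<subseteq> pverts G"
    and iff: "\<And>i j. i \<in> pverts F \<Longrightarrow> j \<in> pverts F \<Longrightarrow> (f i, f j) \<in> parcs G \<longleftrightarrow> (i, j) \<in> parcs F"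
    and F: "parcs F \<subseteq> pverts F \<times> pverts F"
  shows False
proof -
  interpret pair_graph G by fact
  let ?W = "f ` pverts F"
  let ?H = "with_proj G \<restriction> ?W"
  let ?g = "the_inv_into (pverts F) f"
  have H: "induced_subgraph ?H (with_proj G)"
    using f(2) by (intro induced_subgraph_altdef[THEN iffD2] induced_induce) auto
  have g: "?g (f i) = i" if "i \<in> pverts F" for i using the_inv_into_f_f[OF f(1) that] .
  define h where "h = \<lparr>iso_verts = ?g, iso_arcs = map_prod ?g ?g, iso_head = snd, iso_tail = fst\<rparr>"
  have wfH: "wf_digraph ?H" using H by (auto simp: induced_subgraph_def subgraph_def)
  have injg: "inj_on ?g ?W" using f(1) by (simp add: inj_on_the_inv_into)
  have sub: "{e \<in> parcs G. fst e \<in> ?W \<and> snd e \<in> ?W} \<subseteq> ?W \<times> ?W" by auto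
  have "inj_on (map_prod ?g ?g) {e \<in> parcs G. fst e \<in> ?W \<and> snd e \<in> ?W}"
    using map_prod_inj_on[OF injg injg] sub by (rule inj_on_subset)
  then have "pre_digraph.digraph_isomorphism ?H h"
    using wfH injg by (auto simp: pre_digraph.digraph_isomorphism_def h_def)
  moreover have "with_proj F = app_iso h ?H"
  proof -
    have "?g ` ?W = pverts F" using g by (auto simp: image_image)
    moreover have "map_prod ?g ?g ` {e \<in> parcs G. fst e \<in> ?W \<and> snd e \<in> ?W} = parcs F"
    proof (intro equalityI subsetI)
      fix e assume "e \<in> map_prod ?g ?g ` {e \<in> parcs G. fst e \<in> ?W \<and> snd e \<in> ?W}"
      then obtain i j where "i \<in> pverts F" "j \<in> pverts F" "(f i, f j) \<in> parcs G"
        "e = map_prod ?g ?g (f i, f j)" by auto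
      then show "e \<in> parcs F" using iff g by simp
    next
      fix e assume "e \<in> parcs F"
      then obtain i j where ij: "e = (i, j)" "(i, j) \<in> parcs F" by (cases e) auto
      then have V: "i \<in> pverts F" "j \<in> pverts F" using F by auto
      then have "(f i, f j) \<in> {e \<in> parcs G. fst e \<in> ?W \<and> snd e \<in> ?W}" using ij iff by auto
      moreover have "e = map_prod ?g ?g (f i, f j)" using g V ij by simp
      ultimately show "e \<in> map_prod ?g ?g ` {e \<in> parcs G. fst e \<in> ?W \<and> snd e \<in> ?W}"
        by (rule rev_image_eqI)
    qed
    ultimately show ?thesis by (simp add: app_iso_def with_proj_def h_def)
  qed
  ultimately have "digraph_iso ?H (with_proj F)" unfolding digraph_iso_def by blast
  then show False using assms(2,3) H unfolding induced_free_def by blast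
qed

text \<open>Connectedness means reachability in the symmetric closure, which adds no arcs to a
  symmetric digraph. If no arc leaves \<open>S\<close>, reachability from a point of
  \<open>S\<close> stays in \<open>S\<close>.\<close>

lemma k_connected_2_edge_leaving:
  assumes G: "pair_graph G" "k_connected 2 G" and X: "X \<subseteq> pverts G" "card X < 2"
    and S: "S \<subseteq> pverts G - X" "S \<noteq> {}" "S \<noteq> pverts G - X"
  shows "\<exists>u\<in>S. \<exists>w\<in>pverts G - X - S. (u, w) \<in> parcs G"
proof (rule ccontr)
  interpret pair_graph G by fact
  assume no: "\<not> ?thesis"
  let ?H = "mk_symmetric (with_proj G \<restriction> (pverts G - X))"
  have sym: "(v, u) \<in> parcs G" if "(u, v) \<in> parcs G" for u v
    using pair_sym_arcs that by (auto simp: symmetric_def sym_def)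
  obtain s t where st: "s \<in> S" "t \<in> pverts G - X" "t \<notin> S" using S by blast
  have "connected (with_proj G \<restriction> (pverts G - X))" using G(2) X by (simp add: k_connected_def)
  then have "s \<rightarrow>\<^sup>*\<^bsub>with_proj ?H\<^esub> t"
    using st S(1) by (auto simp: connected_def strongly_connected_def mk_symmetric_def)
  then have "(s, t) \<in> rtrancl_on (pverts ?H) (parcs ?H)" by (simp add: reachable_def)
  then have "t \<in> S"
  proof (induction rule: rtrancl_on_induct)
    case base
    then show ?case using st by simp
  next
    case (step y z)
    then have "(y, z) \<in> parcs G" "z \<in> pverts G - X"
      using sym by (auto simp: mk_symmetric_def)
    then show ?case using no step by blast
  qed
  then show False using st by simp
qed

context two_connected_claw_P6_free
begin

lemma chorded_cycle_list:
  assumes n: "13 \<le> card V" and m: "4 \<le> m" "m \<le> card V"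
  shows "\<exists>xs u v. cyc xs \<and> length xs = m \<and> u \<in> set xs \<and> v \<in> set xs \<and> E u v \<and>
    (u, v) \<notin> set (zip xs (tl xs @ [hd xs])) \<and> (v, u) \<notin> set (zip xs (tl xs @ [hd xs]))"
proof -
  consider "m = 4" | "m = 5" | "m = 6" | "7 \<le> m" using m by linarith
  then show ?thesis
  proof cases
    case 1
    obtain a b c d where "distinct [a, b, c, d]" "E a b" "E b c" "E c d" "E d a" "E a c"
      using diamond_exists[OF n] unfolding diamond_free_def by blast
    then show ?thesis using 1
      by (intro exI[of _ "[a, b, c, d]"] exI[of _ a] exI[of _ c]) (auto simp: cyc_def)
  next
    case 2
    obtain a b c d e where "distinct [a, b, c, d, e]" "E a b" "E b c" "E c d" "E d e" "E e a" "E a c"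
      using house_exists[OF n] unfolding house_free_def by blast
    then show ?thesis using 2
      by (intro exI[of _ "[a, b, c, d, e]"] exI[of _ a] exI[of _ c]) (auto simp: cyc_def)
  next
    case 3
    obtain a b c d e f where *: "distinct [a, b, c, d, e, f]" "E a b" "E b c" "E c d" "E d e"
      "E e f" "E f a"
      and "E a c \<or> E a d"
      using chorded_C6_exists[OF n] unfolding chorded_C6_free_def by blast
    then consider "E a c" | "E a d" by blast
    then show ?thesis
    proof cases
      case 1
      then show ?thesis using 3 *
        by (intro exI[of _ "[a, b, c, d, e, f]"] exI[of _ a] exI[of _ c]) (auto simp: cyc_def)
    next
      case 2
      then show ?thesis using 3 *
        by (intro exI[of _ "[a, b, c, d, e, f]"] exI[of _ a] exI[of _ d]) (auto simp: cyc_def)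
    qed
  next
    case 4
    obtain C where C: "cyc C" "length C = m" using cycles_of_all_lengths[OF n, of m] 4 m by auto
    then obtain a b c d e f g R where abc: "C = a # b # c # d # e # f # g # R"
      using 4 by (auto simp: Suc_le_length_iff numeral_eq_Suc)
    have dist: "distinct (a # b # c # d # e # f # g # R)" using C(1) abc by (simp add: cyc_def)
    have *: "distinct [a, b, c, d, e, f]" "E a b" "E b c" "E c d" "E d e" "E e f"
      using C(1) abc by (auto simp: cyc_def)
    have zip: "(x, y) \<in> set (zip C (tl C @ [hd C])) \<longleftrightarrow>
      (x, y) \<in> {(a, b), (b, c), (c, d), (d, e), (e, f), (f, g)}"
      if "x \<in> {a, b, c, d, e, f}" for x y
      using that dist by (auto simp: abc dest: set_zip_leftD)
    have nc: "(u, v) \<notin> set (zip C (tl C @ [hd C]))" "(v, u) \<notin> set (zip C (tl C @ [hd C]))"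
      if "(u, v) \<in> {(a, c), (a, d), (a, e), (a, f), (b, d), (b, e), (b, f), (c, e), (c, f), (d,
        f)}" for u v
      using that dist by (auto simp: zip)
    \<comment> \<open>Six consecutive vertices of the cycle do not form an induced path. As
      \<open>g\<close> follows \<open>f\<close>, even the pair \<open>a\<close>, \<open>f\<close> is
      not an edge of the cycle; at length 6 it would be the closing edge.\<close>
    obtain u v where uv:
      "(u, v) \<in> {(a, c), (a, d), (a, e), (a, f), (b, d), (b, e), (b, f), (c, e), (c, f), (d, f)}"
        "E u v"
      using P6_free[OF *] by blast
    have "u \<in> set C" "v \<in> set C" using uv(1) abc by auto
    then show ?thesis using C uv(2) nc[OF uv(1)] by blast
  qed
qed

end

theorem theorem10:
  fixes G :: "'a pair_pre_digraph" and n :: nat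
  assumes "pair_graph G"
    and "card (pverts G) = n"
    and "n \<ge> 13"
    and "k_connected 2 G"
    and "induced_free {claw, path_graph 6} G"
  shows "chorded_pancyclic G"
proof -
  interpret pair_graph G by fact
  let ?E = "\<lambda>u v. (u, v) \<in> parcs G"
  have sym: "?E v u" if "?E u v" for u v
    using pair_sym_arcs that by (auto simp: symmetric_def sym_def)
  have irr: "\<not> ?E u u" for u using pair_no_loops by fastforce
  have V: "u \<in> pverts G" "v \<in> pverts G" if "?E u v" for u v using that in_arcsD1 in_arcsD2 by auto
  interpret two_connected_claw_P6_free "pverts G" ?E
  proof
    show "finite (pverts G)" by (rule pair_finite_verts)
    show "?E v u" if "?E u v" for u v using sym that .
    show "\<not> ?E u u" for u by (rule irr)
    show "u \<in> pverts G" if "?E u v" for u v using V(1) that .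
    show "?E a b \<or> ?E a c \<or> ?E b c"
      if *: "?E x a" "?E x b" "?E x c" "a \<noteq> b" "a \<noteq> c" "b \<noteq> c" for x a b c
    proof (rule ccontr)
      assume no: "\<not> ?thesis"
      define f where "f i = [x, a, b, c] ! i" for i
      have no': "\<not> ?E b a" "\<not> ?E c a" "\<not> ?E c b" using no sym by blast+
      have ne: "x \<noteq> a" "x \<noteq> b" "x \<noteq> c" using * irr by auto
      have f: "f 0 = x" "f 1 = a" "f 2 = b" "f 3 = c" "f (Suc 0) = a" by (auto simp: f_def)
      show False
      proof (rule induced_copy_not_free[OF assms(1) _ assms(5), of claw f])
        show "inj_on f (pverts claw)" using *(4-6) ne by (auto simp: inj_on_def claw_def f)
        show "f ` pverts claw \<subseteq> pverts G" using * V by (auto simp: claw_def f)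
        show "?E (f i) (f j) \<longleftrightarrow> (i, j) \<in> parcs claw" if "i \<in> pverts claw" "j \<in> pverts claw" for i j
          using that *(1-3) no no' sym[OF *(1)] sym[OF *(2)] sym[OF *(3)] irr
            by (auto simp: claw_def f)
      qed (auto simp: claw_def)
    qed
    show "?E a c \<or> ?E a d \<or> ?E a e \<or> ?E a f \<or> ?E b d \<or> ?E b e \<or> ?E b f \<or> ?E c e \<or> ?E c f \<or> ?E d f"
      if *: "distinct [a, b, c, d, e, f]" "?E a b" "?E b c" "?E c d" "?E d e" "?E e f" for a b c d e f
    proof (rule ccontr)
      assume no: "\<not> ?thesis"
      define g where "g i = [a, b, c, d, e, f] ! i" for i
      have g: "g 0 = a" "g 1 = b" "g 2 = c" "g 3 = d" "g 4 = e" "g 5 = f" "g (Suc 0) = b"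
        by (auto simp: g_def)
      have six: "i \<in> pverts (path_graph 6) \<longleftrightarrow> i \<in> {0, 1, 2, 3, 4, 5}" for i
        by (auto simp: path_graph_def)
      have no': "\<not> ?E c a" "\<not> ?E d a" "\<not> ?E e a" "\<not> ?E f a" "\<not> ?E d b" "\<not> ?E e b" "\<not> ?E f b"
        "\<not> ?E e c" "\<not> ?E f c" "\<not> ?E f d" using no sym by blast+
      show False
      proof (rule induced_copy_not_free[OF assms(1) _ assms(5), of "path_graph 6" g])
        show "inj_on g (pverts (path_graph 6))" using *(1) by (auto simp: inj_on_def six g)
        show "g ` pverts (path_graph 6) \<subseteq> pverts G" using * V by (auto simp: six g)
        show "?E (g i) (g j) \<longleftrightarrow> (i, j) \<in> parcs (path_graph 6)"
          if "i \<in> pverts (path_graph 6)" "j \<in> pverts (path_graph 6)" for i j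
          using that unfolding six
          by (elim insertE emptyE) (simp_all add: path_graph_def g *(2-) no[simplified] no' irr
            sym[OF *(2)] sym[OF *(3)] sym[OF *(4)] sym[OF *(5)] sym[OF *(6)])
      qed (auto simp: path_graph_def)
    qed
    show "\<exists>u\<in>S. \<exists>w\<in>pverts G - X - S. ?E u w"
      if "X \<subseteq> pverts G" "card X < 2" "S \<subseteq> pverts G - X" "S \<noteq> {}" "S \<noteq> pverts G - X" for X S
      using k_connected_2_edge_leaving[OF assms(1,4) that] .
  qed
  show ?thesis unfolding chorded_pancyclic_def
  proof (intro allI impI)
    fix m assume m: "4 \<le> m \<and> m \<le> card (pverts G)"
    obtain xs u v where "cyc xs" "length xs = m" "u \<in> set xs" "v \<in> set xs" "?E u v"
      "(u, v) \<notin> set (zip xs (tl xs @ [hd xs]))" "(v, u) \<notin> set (zip xs (tl xs @ [hd xs]))"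
      using chorded_cycle_list[of m] assms(2,3) m by auto
    then show "\<exists>p. chorded_cycle G p \<and> length p = m"
      using chorded_cycleI[OF assms(1), of xs u v] by (auto simp: cyc_def)
  qed
qed

end
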